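(* Let $F:\mathbb{R}^d\to\mathbb{R}$ be bounded, $c>0$, and $\beta\in\mathbb{N}^d$ with $|\beta|=\Omega(d)$ (i.e., $|\beta|\ge c_0d$ for a fixed constant $c_0>0$). Then $$\|\partial^\beta\tilde F^c\|_\infty\le\|F\|_\infty\cdot c^{|\beta|}\cdot2^{O(|\beta|)}\cdot\sqrt{\beta!\cdot|\beta|^{-|\beta|}}.$$
   Context: Let $b(x)=\sqrt{C_d}(1-\|x\|_2^2)$ for $\|x\|_2<1$ and $0$ otherwise, with $C_d>0$ chosen so $\|b\|_2=1$; $\hat b(t)=(2\pi)^{-d/2}\int b(x)e^{-i\langle x,t\rangle}dx$; $B=\hat b^2$; $B_c(x)=c^dB(cx)$; the FT-mollification is $\tilde F^c(x)=\int_{\mathbb R^d}B_c(y)F(x-y)dy$. For $\beta\in\mathbb N^d$: $|\beta|=\sum_i\beta_i$, $\beta!=\prod_i\beta_i!$, $\partial^\beta=\partial^{|\beta|}/\partial x_1^{\beta_1}\cdots\partial x_d^{\beta_d}$. *)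

theory Defs
  imports "HOL-Analysis.Analysis"
begin

text \<open>
  The dimension has to be a number that can be quantified after the implied constants of an
  asymptotic bound, so points of d-dimensional real space are extensional functions
  on \<open>{..<d}\<close> instead of elements of a Euclidean-space type. Coordinates are numbered from 0.
\<close>

definition rspace :: "nat \<Rightarrow> (nat \<Rightarrow> real) set" where
  "rspace d = {..<d} \<rightarrow>\<^sub>E UNIV"

text \<open>Lebesgue measure; the completion makes all Lebesgue measurable functions admissible.\<close>

definition lebesgue_d :: "nat \<Rightarrow> (nat \<Rightarrow> real) measure" where
  "lebesgue_d d = completion (PiM {..<d} (\<lambda>_. lborel))"

definition vdiff :: "nat \<Rightarrow> (nat \<Rightarrow> real) \<Rightarrow> (nat \<Rightarrow> real) \<Rightarrow> (nat \<Rightarrow> real)" where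
  "vdiff d x y = (\<lambda>i\<in>{..<d}. x i - y i)"

definition vscale :: "nat \<Rightarrow> real \<Rightarrow> (nat \<Rightarrow> real) \<Rightarrow> (nat \<Rightarrow> real)" where
  "vscale d c x = (\<lambda>i\<in>{..<d}. c * x i)"

definition bump_with :: "nat \<Rightarrow> real \<Rightarrow> (nat \<Rightarrow> real) \<Rightarrow> real" where
  "bump_with d C x =
     (if L2_set x {..<d} < 1 then sqrt C * (1 - (L2_set x {..<d})\<^sup>2) else 0)"

definition bump_const :: "nat \<Rightarrow> real" where
  "bump_const d = (THE C. 0 < C \<and> sqrt (LINT x|lebesgue_d d. \<bar>bump_with d C x\<bar>\<^sup>2) = 1)"

definition bump :: "nat \<Rightarrow> (nat \<Rightarrow> real) \<Rightarrow> real" where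
  "bump d = bump_with d (bump_const d)"

definition bump_hat :: "nat \<Rightarrow> (nat \<Rightarrow> real) \<Rightarrow> complex" where
  "bump_hat d t = of_real ((2 * pi) powr (- real d / 2)) *
     (LINT x|lebesgue_d d.
        of_real (bump d x) * exp (- \<i> * of_real (\<Sum>i<d. x i * t i)))"

text \<open>
  The Fourier transform is real-valued since \<open>bump\<close> is even (see \<open>bump_hat_real\<close> below), so
  taking the real part only changes the type.
\<close>

definition kernel :: "nat \<Rightarrow> (nat \<Rightarrow> real) \<Rightarrow> real" where
  "kernel d t = Re ((bump_hat d t)\<^sup>2)"

definition kernel_scaled :: "nat \<Rightarrow> real \<Rightarrow> (nat \<Rightarrow> real) \<Rightarrow> real" where
  "kernel_scaled d c x = c ^ d * kernel d (vscale d c x)"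

definition ft_mollify ::
    "nat \<Rightarrow> real \<Rightarrow> ((nat \<Rightarrow> real) \<Rightarrow> real) \<Rightarrow> (nat \<Rightarrow> real) \<Rightarrow> real" where
  "ft_mollify d c F x = (LINT y|lebesgue_d d. kernel_scaled d c y * F (vdiff d x y))"

definition mi_abs :: "nat \<Rightarrow> (nat \<Rightarrow> nat) \<Rightarrow> nat" where
  "mi_abs d \<beta> = (\<Sum>i<d. \<beta> i)"

definition mi_fact :: "nat \<Rightarrow> (nat \<Rightarrow> nat) \<Rightarrow> nat" where
  "mi_fact d \<beta> = (\<Prod>i<d. fact (\<beta> i))"

definition partial :: "nat \<Rightarrow> ((nat \<Rightarrow> real) \<Rightarrow> real) \<Rightarrow> (nat \<Rightarrow> real) \<Rightarrow> real" where
  "partial i f x = deriv (\<lambda>t. f (x(i := t))) (x i)"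

text \<open>Iterated partial derivatives; the last entry of the list is differentiated first.\<close>

primrec partials :: "nat list \<Rightarrow> ((nat \<Rightarrow> real) \<Rightarrow> real) \<Rightarrow> (nat \<Rightarrow> real) \<Rightarrow> real" where
  "partials [] f = f"
| "partials (i # is) f = partial i (partials is f)"

primrec partials_exist :: "nat \<Rightarrow> nat list \<Rightarrow> ((nat \<Rightarrow> real) \<Rightarrow> real) \<Rightarrow> bool" where
  "partials_exist d [] f \<longleftrightarrow> True"
| "partials_exist d (i # is) f \<longleftrightarrow> partials_exist d is f \<and>
     (\<forall>x\<in>rspace d. (\<lambda>t. partials is f (x(i := t))) differentiable (at (x i)))"

definition mi_list :: "nat \<Rightarrow> (nat \<Rightarrow> nat) \<Rightarrow> nat list" where
  "mi_list d \<beta> = concat (map (\<lambda>i. replicate (\<beta> i) i) [0..<d])"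

definition mi_deriv ::
    "nat \<Rightarrow> (nat \<Rightarrow> nat) \<Rightarrow> ((nat \<Rightarrow> real) \<Rightarrow> real) \<Rightarrow> (nat \<Rightarrow> real) \<Rightarrow> real" where
  "mi_deriv d \<beta> f = partials (mi_list d \<beta>) f"

definition mi_deriv_exists ::
    "nat \<Rightarrow> (nat \<Rightarrow> nat) \<Rightarrow> ((nat \<Rightarrow> real) \<Rightarrow> real) \<Rightarrow> bool" where
  "mi_deriv_exists d \<beta> f \<longleftrightarrow> partials_exist d (mi_list d \<beta>) f"

text \<open>
  The sup norm takes values in \<^typ>\<open>ennreal\<close> so that it is infinite, rather than unspecified,
  for unbounded functions.
\<close>

definition supnorm :: "nat \<Rightarrow> ((nat \<Rightarrow> real) \<Rightarrow> real) \<Rightarrow> ennreal" where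
  "supnorm d f = (SUP x\<in>rspace d. ennreal \<bar>f x\<bar>)"

lemma distr_uminus_PiM_lborel:
  "distr (PiM {..<d} (\<lambda>_. lborel)) (PiM {..<d} (\<lambda>_. lborel)) (vscale d (-1))
     = (PiM {..<d} (\<lambda>_. lborel) :: (nat \<Rightarrow> real) measure)"
proof -
  interpret product_sigma_finite "\<lambda>_::nat. lborel :: real measure" ..
  let ?P = "PiM {..<d} (\<lambda>_. lborel) :: (nat \<Rightarrow> real) measure"
  have m: "vscale d (-1) \<in> measurable ?P ?P"
    unfolding vscale_def by measurable
  show ?thesis
  proof (rule PiM_eqI)
    fix A :: "nat \<Rightarrow> real set"
    assume A: "\<And>i. i \<in> {..<d} \<Longrightarrow> A i \<in> sets lborel"
    have "vscale d (-1) -` Pi\<^sub>E {..<d} A \<inter> space ?P = Pi\<^sub>E {..<d} (\<lambda>i. uminus -` A i)"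
      by (auto simp: vscale_def space_PiM PiE_def Pi_def)
    moreover have u: "uminus -` A i \<in> sets borel" if "i < d" for i
      using measurable_sets[of uminus borel borel "A i"] A[of i] that by auto
    moreover have "emeasure lborel (uminus -` A i) = emeasure lborel (A i)" if "i < d" for i
    proof -
      have "emeasure (distr lborel borel uminus) (A i) = emeasure lborel (uminus -` A i)"
        using A[of i] that by (subst emeasure_distr) auto
      then show ?thesis by (simp add: lborel_distr_uminus)
    qed
    moreover have "emeasure ?P (Pi\<^sub>E {..<d} (\<lambda>i. uminus -` A i))
        = (\<Prod>i\<in>{..<d}. emeasure lborel (uminus -` A i))"
      by (rule emeasure_PiM) (use u in auto)
    ultimately show "emeasure (distr ?P ?P (vscale d (-1))) (Pi\<^sub>E {..<d} A)
        = (\<Prod>i\<in>{..<d}. emeasure lborel (A i))"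
      using A m by (subst emeasure_distr) (auto intro!: sets_PiM_I_finite prod.cong)
  qed auto
qed

lemma bump_hat_real: "bump_hat d t \<in> \<real>"
proof -
  let ?P = "PiM {..<d} (\<lambda>_. lborel) :: (nat \<Rightarrow> real) measure"
  let ?g = "\<lambda>x. of_real (bump d x) * exp (- \<i> * of_real (\<Sum>i<d. x i * t i)) :: complex"
  have s: "vscale d (-1) \<in> measurable ?P ?P"
    unfolding vscale_def by measurable
  have L: "L2_set (vscale d (-1) x) {..<d} = L2_set x {..<d}" for x
    by (auto simp: L2_set_def vscale_def)
  have b: "bump d (vscale d (-1) x) = bump d x" for x
    unfolding bump_def bump_with_def L ..
  have i: "(\<Sum>i<d. vscale d (-1) x i * t i) = - (\<Sum>i<d. x i * t i)" for x
    by (simp add: vscale_def sum_negf)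
  have c: "?g (vscale d (-1) x) = cnj (?g x)" for x
    unfolding b i by (simp add: exp_cnj)
  have g: "?g \<in> borel_measurable ?P"
    unfolding bump_def bump_with_def L2_set_def by measurable
  have "integral\<^sup>L ?P ?g = integral\<^sup>L (distr ?P ?P (vscale d (-1))) ?g"
    by (simp add: distr_uminus_PiM_lborel)
  also have "\<dots> = (LINT x|?P. ?g (vscale d (-1) x))"
    by (rule integral_distr[OF s g])
  also have "\<dots> = (LINT x|?P. cnj (?g x))"
    by (simp only: c)
  also have "\<dots> = cnj (integral\<^sup>L ?P ?g)"
    by (rule Bochner_Integration.integral_cnj)
  finally have "integral\<^sup>L ?P ?g \<in> \<real>"
    by (simp only: Reals_cnj_iff)
  then show ?thesis
    unfolding bump_hat_def lebesgue_d_def integral_completion[OF g]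
    by (intro Reals_mult Reals_of_real)
qed

end

(*
  After the substitution y -> x - y, all derivatives fall on the kernel, so it suffices to bound the
  L^1 norm of the derivative of B. The Leibniz rule for B = bhat^2 gives 2^n products of
  derivatives of bhat (n the order), and Cauchy-Schwarz together with Plancherel bounds each by a
  product of L^2 norms of monomials times b. On the unit ball the square of the monomial with
  exponent gamma is at most gamma!/|gamma|!, a single term of the multinomial expansion of
  (x_1^2 + ... + x_d^2)^|gamma|. Since b has norm 1, each product is at most
  sqrt(2^n beta!/n!), and n! >= (n/4)^n.
*)

theory Submission
  imports Defs "HOL-Probability.Characteristic_Functions"
begin

section \<open>Affine changes of variables\<close>

text \<open>\<open>F\<close> has no regularity, so the existence of the derivatives has to be proved
  as well. What is known about the kernel comes in integrated form: its derivatives are sums of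
  products of square-integrable functions, hence in L^1, with no integrable pointwise majorant at
  hand. The convolution is therefore differentiated with remainders measured in L^1, at the price of
  two derivatives of the kernel for each derivative of the convolution. The price is affordable
  because the L^1 bound is available for every order. Orders of differentiation are lists of
  coordinates rather than multi-indices: one more derivative is one more list entry, and the Leibniz
  rule becomes a recursion over lists without binomial coefficients. The factor c^n is the chain
  rule for the scaled kernel; its normalisation c^d is absorbed by the change of variables. The
  constant is 2^n (Leibniz terms) times the root of 2^n 4^n, that is 2^(5n/2), rounded up to
  2^(3n).\<close>

abbreviation lborel_d :: "nat \<Rightarrow> (nat \<Rightarrow> real) measure" where
  "lborel_d d \<equiv> PiM {..<d} (\<lambda>_. lborel)"

text \<open>One map for all substitutions used below: scaling (x = 0), reflection (a = -1) and
  translation (a = 1).\<close>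

definition vaffine :: "nat \<Rightarrow> (nat \<Rightarrow> real) \<Rightarrow> real \<Rightarrow> (nat \<Rightarrow> real) \<Rightarrow> nat \<Rightarrow> real" where
  "vaffine d x a y = (\<lambda>i\<in>{..<d}. x i + a * y i)"

lemma product_sigma_finite_lborel: "product_sigma_finite (\<lambda>_::nat. lborel :: real measure)"
  ..

lemma sigma_finite_lborel_d: "sigma_finite_measure (lborel_d d)"
  by (rule product_sigma_finite.sigma_finite[OF product_sigma_finite_lborel]) simp

lemma pair_sigma_finite_lborel_d: "pair_sigma_finite (lborel_d d) (lborel_d d)"
  by (intro pair_sigma_finite.intro sigma_finite_lborel_d)

lemma space_lborel_d: "space (lborel_d d) = rspace d"
  by (simp add: space_PiM rspace_def)

lemma measurable_vaffine [measurable]: "vaffine d x a \<in> measurable (lborel_d d) (lborel_d d)"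
  unfolding vaffine_def by measurable

text \<open>A product measure is determined by its values on boxes. On a box the map acts coordinate
  by coordinate, so the one-dimensional rule contributes a factor |a| for each of the d
  coordinates.\<close>

lemma lborel_d_affine:
  assumes "a \<noteq> 0"
  shows "lborel_d d
    = density (distr (lborel_d d) (lborel_d d) (vaffine d x a)) (\<lambda>_. ennreal (\<bar>a\<bar> ^ d))"
proof -
  interpret product_sigma_finite "\<lambda>_::nat. lborel :: real measure" ..
  let ?P = "lborel_d d"
  show ?thesis
  proof (rule PiM_eqI[symmetric])
    fix A :: "nat \<Rightarrow> real set"
    assume A: "\<And>i. i \<in> {..<d} \<Longrightarrow> A i \<in> sets lborel"
    let ?B = "\<lambda>i. (\<lambda>s. x i + a * s) -` A i"
    have pre: "vaffine d x a -` Pi\<^sub>E {..<d} A \<inter> space ?P = Pi\<^sub>E {..<d} ?B"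
      by (auto simp: vaffine_def space_PiM PiE_def Pi_def)
    have u: "?B i \<in> sets borel" if "i < d" for i
      using measurable_sets[of "\<lambda>s. x i + a * s" borel borel "A i"] A[of i] that by auto
    have em: "ennreal \<bar>a\<bar> * emeasure lborel (?B i) = emeasure lborel (A i)" if "i < d" for i
    proof -
      have "emeasure lborel (A i)
          = emeasure (density (distr lborel borel (\<lambda>s. x i + a * s)) (\<lambda>_. ennreal \<bar>a\<bar>)) (A i)"
        using lborel_real_affine[OF assms, of "x i"] by simp
      also have "\<dots> = ennreal \<bar>a\<bar> * emeasure lborel (?B i)"
        using A[of i] that
        by (subst emeasure_density) (auto simp: nn_integral_cmult emeasure_distr)
      finally show ?thesis ..
    qed
    have S: "Pi\<^sub>E {..<d} A \<in> sets ?P"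
      using A by (auto intro!: sets_PiM_I_finite)
    have "emeasure (density (distr ?P ?P (vaffine d x a)) (\<lambda>_. ennreal (\<bar>a\<bar> ^ d))) (Pi\<^sub>E {..<d} A)
        = ennreal (\<bar>a\<bar> ^ d) * emeasure ?P (Pi\<^sub>E {..<d} ?B)"
      using S by (subst emeasure_density) (auto simp: nn_integral_cmult emeasure_distr pre)
    also have "emeasure ?P (Pi\<^sub>E {..<d} ?B) = (\<Prod>i\<in>{..<d}. emeasure lborel (?B i))"
      by (rule emeasure_PiM) (use u in auto)
    also have "ennreal (\<bar>a\<bar> ^ d) * \<dots> = (\<Prod>i\<in>{..<d}. ennreal \<bar>a\<bar> * emeasure lborel (?B i))"
      by (simp add: prod.distrib ennreal_power)
    also have "\<dots> = (\<Prod>i\<in>{..<d}. emeasure lborel (A i))"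
      by (rule prod.cong) (auto simp: em)
    finally show "emeasure (density (distr ?P ?P (vaffine d x a)) (\<lambda>_. ennreal (\<bar>a\<bar> ^ d)))
        (Pi\<^sub>E {..<d} A) = (\<Prod>i\<in>{..<d}. emeasure lborel (A i))" .
  qed auto
qed

lemma nn_integral_vaffine:
  assumes "a \<noteq> 0" and [measurable]: "f \<in> borel_measurable (lborel_d d)"
  shows "(\<integral>\<^sup>+y. f y \<partial>lborel_d d) = ennreal (\<bar>a\<bar> ^ d) * (\<integral>\<^sup>+y. f (vaffine d x a y) \<partial>lborel_d d)"
  by (subst lborel_d_affine[OF assms(1), of d x])
     (simp add: nn_integral_density nn_integral_distr nn_integral_cmult)

lemma integral_vaffine:
  fixes f :: "(nat \<Rightarrow> real) \<Rightarrow> real"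
  assumes "a \<noteq> 0" and [measurable]: "f \<in> borel_measurable (lborel_d d)"
  shows "(LINT y|lborel_d d. f y) = \<bar>a\<bar> ^ d * (LINT y|lborel_d d. f (vaffine d x a y))"
  by (subst lborel_d_affine[OF assms(1), of d x])
     (simp add: integral_density integral_distr)

text \<open>The change of variables, applied to the indicator of an exceptional null set, shows that
  its preimage is null as well.\<close>

lemma AE_vaffine:
  assumes "a \<noteq> 0" and ae: "AE y in lborel_d d. Q y"
  shows "AE y in lborel_d d. Q (vaffine d x a y)"
proof -
  let ?P = "lborel_d d"
  obtain N where N: "{y \<in> space ?P. \<not> Q y} \<subseteq> N" "N \<in> null_sets ?P"
    using ae unfolding eventually_ae_filter by auto
  have [measurable]: "N \<in> sets ?P" using N by auto
  have "0 = ennreal (\<bar>a\<bar> ^ d) * (\<integral>\<^sup>+y. indicator N (vaffine d x a y) \<partial>?P)"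
    using N by (subst nn_integral_vaffine[OF assms(1), symmetric]) auto
  moreover have "ennreal (\<bar>a\<bar> ^ d) \<noteq> 0"
    using assms(1) by (simp add: ennreal_eq_0_iff not_le)
  ultimately have "(\<integral>\<^sup>+y. indicator N (vaffine d x a y) \<partial>?P) = 0"
    by (metis mult_eq_0_iff)
  then have "AE y in ?P. indicator N (vaffine d x a y) = (0::ennreal)"
    by (subst (asm) nn_integral_0_iff_AE) auto
  moreover have "AE y in ?P. vaffine d x a y \<in> space ?P"
    using measurable_space[OF measurable_vaffine] by (auto intro!: AE_I2)
  ultimately show ?thesis
    by eventually_elim (use N(1) in \<open>auto simp: indicator_def split: if_splits\<close>)
qed

section \<open>Gaussian weights\<close>

text \<open>For a non-integrable \<open>f\<close> the left side is 0, the default value of the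
  Bochner integral.\<close>

lemma norm_integral_le_nn_integral:
  fixes f :: "'a \<Rightarrow> 'b::{banach, second_countable_topology}"
  shows "ennreal (norm (integral\<^sup>L M f)) \<le> (\<integral>\<^sup>+x. ennreal (norm (f x)) \<partial>M)"
  by (cases "integrable M f") (auto simp: integral_norm_bound_ennreal not_integrable_integral_eq)

lemma integrable_mult_product:
  fixes f :: "'a \<Rightarrow> real" and g :: "'b \<Rightarrow> real"
  assumes "pair_sigma_finite M N" and f: "integrable M f" and g: "integrable N g"
  shows "integrable (M \<Otimes>\<^sub>M N) (\<lambda>(x, y). f x * g y)"
proof -
  interpret pair_sigma_finite M N by fact
  have [measurable]: "f \<in> borel_measurable M" "g \<in> borel_measurable N"
    using f g by auto
  show ?thesis
  proof (rule Fubini_integrable)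
    show "integrable M (\<lambda>x. LINT y|N. norm (case (x, y) of (x, y) \<Rightarrow> f x * g y))"
      using f by (simp add: abs_mult)
  qed (use g in auto)
qed

text \<open>The known characteristic function of the standard normal distribution, evaluated at -u/e
  and rescaled by r = e s, so that the phase (-u/e) r becomes -u s.\<close>

lemma gaussian_fourier_1d:
  fixes e u :: real
  assumes e: "0 < e"
  shows "integrable lborel (\<lambda>s. exp (- \<i> * of_real (u * s)) * complex_of_real (exp (- (e * s)\<^sup>2 / 2)))"
    and "(LINT s|lborel. exp (- \<i> * of_real (u * s)) * complex_of_real (exp (- (e * s)\<^sup>2 / 2)))
      = of_real (2 * pi * normal_density 0 e u)"
proof -
  let ?w = "\<lambda>s. exp (- (e * s)\<^sup>2 / 2)"
  have "integrable lborel (\<lambda>s. std_normal_density (0 + e * s))"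
    using e by (intro lborel_integrable_real_affine) (auto intro: integrable_normal_density)
  then have "integrable lborel (\<lambda>s. sqrt (2 * pi) * std_normal_density (0 + e * s))"
    by (rule integrable_mult_right)
  also have "(\<lambda>s. sqrt (2 * pi) * std_normal_density (0 + e * s)) = ?w"
    by (simp add: std_normal_density_def)
  finally have iw: "integrable lborel ?w" .
  then show "integrable lborel (\<lambda>s. exp (- \<i> * of_real (u * s)) * complex_of_real (?w s))"
    by (rule Bochner_Integration.integrable_bound) (auto simp: norm_mult)
  have "complex_of_real (exp (- ((- u / e)\<^sup>2) / 2)) = char std_normal_distribution (- u / e)"
    by (simp add: char_std_normal_distribution)
  also have "\<dots> = (LINT r|lborel. std_normal_density r *\<^sub>R iexp ((- u / e) * r))"
    unfolding char_def by (subst integral_density) auto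
  also have "\<dots> = \<bar>e\<bar> *\<^sub>R (LINT s|lborel. std_normal_density (0 + e * s) *\<^sub>R iexp ((- u / e) * (0 + e * s)))"
    using e by (intro lborel_integral_real_affine) auto
  also have "(\<lambda>s. std_normal_density (0 + e * s) *\<^sub>R iexp ((- u / e) * (0 + e * s)))
     = (\<lambda>s. of_real (1 / sqrt (2 * pi)) * (exp (- \<i> * of_real (u * s)) * complex_of_real (?w s)))"
    using e by (auto simp: std_normal_density_def scaleR_conv_of_real)
  finally have "complex_of_real (exp (- (u / e)\<^sup>2 / 2)) = of_real (e / sqrt (2 * pi)) *
      (LINT s|lborel. exp (- \<i> * of_real (u * s)) * complex_of_real (?w s))" (is "_ = _ * ?I")
    using e by (simp add: scaleR_conv_of_real power_divide)
  then have "?I = of_real (sqrt (2 * pi) / e * exp (- (u / e)\<^sup>2 / 2))"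
    using e by (simp add: field_simps)
  also have "sqrt (2 * pi) / e * exp (- (u / e)\<^sup>2 / 2) = 2 * pi * normal_density 0 e u"
    using e by (simp add: normal_density_def real_sqrt_mult field_simps power_divide
        flip: power2_eq_square)
  finally show "?I = of_real (2 * pi * normal_density 0 e u)" .
qed

definition gauss_weight :: "nat \<Rightarrow> real \<Rightarrow> (nat \<Rightarrow> real) \<Rightarrow> real" where
  "gauss_weight d e t = (\<Prod>i<d. exp (- (e * t i)\<^sup>2 / 2))"

text \<open>Up to the factor (2 pi)^d this is the Fourier transform of
  \<open>gauss_weight d e\<close> at x - y. It is a probability density in y.\<close>

definition gauss_kernel :: "nat \<Rightarrow> real \<Rightarrow> (nat \<Rightarrow> real) \<Rightarrow> (nat \<Rightarrow> real) \<Rightarrow> real" where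
  "gauss_kernel d e x y = (\<Prod>i<d. normal_density 0 e (x i - y i))"

lemma gauss_weight_measurable [measurable]: "gauss_weight d e \<in> borel_measurable (lborel_d d)"
  unfolding gauss_weight_def by measurable

lemma gauss_weight_nonneg [simp]: "0 \<le> gauss_weight d e t"
  unfolding gauss_weight_def by (intro prod_nonneg) auto

lemma gauss_kernel_nonneg [simp]: "0 \<le> gauss_kernel d e x y"
  unfolding gauss_kernel_def by (intro prod_nonneg) auto

lemma gauss_kernel_measurable [measurable]:
  "(\<lambda>(x, y). gauss_kernel d e x y) \<in> borel_measurable (lborel_d d \<Otimes>\<^sub>M lborel_d d)"
  unfolding gauss_kernel_def normal_density_def by measurable

lemma gauss_kernel_measurable2 [measurable]:
  "(\<lambda>y. gauss_kernel d e x y) \<in> borel_measurable (lborel_d d)"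
  unfolding gauss_kernel_def normal_density_def by measurable

lemma gauss_kernel_commute: "gauss_kernel d e x y = gauss_kernel d e y x"
  unfolding gauss_kernel_def normal_density_def by (simp add: power2_commute)

lemma integrable_gauss_weight:
  assumes "0 < e"
  shows "integrable (lborel_d d) (gauss_weight d e)"
proof -
  interpret product_sigma_finite "\<lambda>_::nat. lborel :: real measure" ..
  have "integrable lborel (\<lambda>s. exp (- (e * s)\<^sup>2 / 2))"
    using integrable_norm[OF gaussian_fourier_1d(1)[OF assms, of 0]] by (simp del: of_real_exp)
  then show ?thesis
    unfolding gauss_weight_def by (intro product_integrable_prod) auto
qed

lemma gaussian_fourier:
  assumes "0 < e"
  shows "(LINT t|lborel_d d. exp (- \<i> * of_real (\<Sum>i<d. u i * t i)) * complex_of_real (gauss_weight d e t))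
    = of_real ((2 * pi) ^ d * (\<Prod>i<d. normal_density 0 e (u i)))"
proof -
  interpret product_sigma_finite "\<lambda>_::nat. lborel :: real measure" ..
  have "(LINT t|lborel_d d. exp (- \<i> * of_real (\<Sum>i<d. u i * t i)) * complex_of_real (gauss_weight d e t))
    = (LINT t|lborel_d d. (\<Prod>i<d. exp (- \<i> * of_real (u i * t i)) * complex_of_real (exp (- (e * t i)\<^sup>2 / 2))))"
    by (simp add: gauss_weight_def prod.distrib sum_distrib_left sum_negf [symmetric] exp_sum
        del: of_real_exp)
  also have "\<dots> = (\<Prod>i<d. of_real (2 * pi * normal_density 0 e (u i)))"
    by (subst product_integral_prod)
       (use gaussian_fourier_1d[OF assms] in \<open>auto simp del: of_real_exp of_real_mult\<close>)
  finally show ?thesis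
    by (simp add: prod.distrib)
qed

lemma nn_integral_gauss_kernel:
  assumes "0 < e"
  shows "(\<integral>\<^sup>+y. ennreal (gauss_kernel d e x y) \<partial>lborel_d d) = 1"
proof -
  interpret product_sigma_finite "\<lambda>_::nat. lborel :: real measure" ..
  have 1: "(\<integral>\<^sup>+s. ennreal (normal_density 0 e (r - s)) \<partial>lborel) = 1" for r
  proof -
    have "normal_density 0 e (r - s) = normal_density r e s" for s
      by (simp add: normal_density_def power2_commute)
    then show ?thesis
      using assms by (simp add: nn_integral_eq_integral)
  qed
  have "(\<integral>\<^sup>+y. ennreal (gauss_kernel d e x y) \<partial>lborel_d d)
      = (\<integral>\<^sup>+y. (\<Prod>i<d. ennreal (normal_density 0 e (x i - y i))) \<partial>lborel_d d)"
    by (simp add: gauss_kernel_def prod_ennreal)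
  also have "\<dots> = (\<Prod>i<d. \<integral>\<^sup>+s. ennreal (normal_density 0 e (x i - s)) \<partial>lborel)"
    by (rule product_nn_integral_prod) auto
  finally show ?thesis
    by (simp add: 1)
qed

section \<open>Bessel's inequality for the Fourier transform\<close>

definition wave :: "nat \<Rightarrow> (nat \<Rightarrow> real) \<Rightarrow> (nat \<Rightarrow> real) \<Rightarrow> complex" where
  "wave d x t = exp (- \<i> * of_real (\<Sum>i<d. x i * t i))"

text \<open>The unitary normalisation, as in \<open>bump_hat\<close>; with it the constant in
  Bessel's inequality is 1.\<close>

definition fourier :: "nat \<Rightarrow> ((nat \<Rightarrow> real) \<Rightarrow> complex) \<Rightarrow> (nat \<Rightarrow> real) \<Rightarrow> complex" where
  "fourier d g t = of_real ((2 * pi) powr (- real d / 2)) * (LINT x|lborel_d d. g x * wave d x t)"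

lemma norm_wave [simp]: "norm (wave d x t) = 1"
  by (simp add: wave_def)

lemma wave_measurable [measurable]:
  "(\<lambda>(x, t). wave d x t) \<in> borel_measurable (lborel_d d \<Otimes>\<^sub>M lborel_d d)"
  unfolding wave_def by measurable

lemma wave_measurable1 [measurable]: "(\<lambda>x. wave d x t) \<in> borel_measurable (lborel_d d)"
  unfolding wave_def by measurable

lemma wave_measurable2 [measurable]: "(\<lambda>t. wave d x t) \<in> borel_measurable (lborel_d d)"
  unfolding wave_def by measurable

lemma wave_cnj_mult: "cnj (wave d y t) * wave d x t = exp (- \<i> * of_real (\<Sum>i<d. (x i - y i) * t i))"
  by (simp add: wave_def exp_cnj exp_add [symmetric] algebra_simps sum_subtractf)

lemma fourier_measurable [measurable]:
  assumes [measurable]: "g \<in> borel_measurable (lborel_d d)"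
  shows "fourier d g \<in> borel_measurable (lborel_d d)"
proof -
  interpret sigma_finite_measure "lborel_d d" by (rule sigma_finite_lborel_d)
  show ?thesis
    unfolding fourier_def by measurable
qed

text \<open>
  Only one half of Plancherel's theorem is needed. Against a Gaussian weight in \<open>t\<close> the left
  side becomes a convolution quadratic form with a probability density as kernel, which is at most
  the squared norm of \<open>g\<close> since \<open>2 * a * b \<le> a\<^sup>2 + b\<^sup>2\<close>; no convergence of
  approximate identities is required.
\<close>

lemma gauss_weighted_bessel:
  assumes e: "0 < e" and g: "integrable (lborel_d d) g"
  shows "(\<integral>\<^sup>+t. ennreal (gauss_weight d e t * (norm (fourier d g t))\<^sup>2) \<partial>lborel_d d)
    \<le> (\<integral>\<^sup>+x. ennreal ((norm (g x))\<^sup>2) \<partial>lborel_d d)"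
proof -
  let ?P = "lborel_d d" and ?W = "gauss_weight d e" and ?N = "gauss_kernel d e"
  interpret pair_sigma_finite ?P ?P by (rule pair_sigma_finite_lborel_d)
  have [measurable]: "g \<in> borel_measurable ?P"
    using g by auto
  have [measurable]: "cnj \<in> borel_measurable borel"
    by (intro borel_measurable_continuous_onI continuous_intros)
  define I where "I t = (LINT x|?P. g x * wave d x t)" for t
  have [measurable]: "I \<in> borel_measurable ?P"
    unfolding I_def by measurable
  \<comment> \<open>A uniform bound on \<open>I\<close>; it supplies the majorants for the weighted
    square of \<open>I\<close> and for the second exchange of integrals.\<close>
  define C where "C = (LINT x|?P. norm (g x))"
  have C: "norm (I t) \<le> C" for t
  proof -
    have "norm (I t) \<le> (LINT x|?P. norm (g x * wave d x t))"
      unfolding I_def by (rule integral_norm_bound)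
    then show ?thesis by (simp add: C_def norm_mult)
  qed
  have C0: "0 \<le> C"
    unfolding C_def by simp
  have W: "integrable ?P ?W"
    by (rule integrable_gauss_weight[OF e])
  have pI: "integrable (?P \<Otimes>\<^sub>M ?P) (\<lambda>(x, t). norm (g x) * ?W t)"
    by (rule integrable_mult_product[OF pair_sigma_finite_lborel_d]) (use g W in auto)

  have cI: "cnj (I t) = (LINT y|?P. cnj (g y * wave d y t))" for t
    unfolding I_def by (rule Bochner_Integration.integral_cnj [symmetric])
  \<comment> \<open>Integrating over t before y leaves the Fourier transform of the Gaussian weight
    at x - y, which is known explicitly.\<close>
  have inner: "(LINT t|?P. of_real (?W t) * wave d x t * cnj (I t))
      = (LINT y|?P. cnj (g y) * of_real ((2 * pi) ^ d * ?N x y))" for x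
  proof -
    have "(LINT t|?P. of_real (?W t) * wave d x t * cnj (I t))
        = (LINT t|?P. (LINT y|?P. of_real (?W t) * wave d x t * cnj (g y * wave d y t)))"
      by (simp only: cI integral_mult_right_zero)
    also have "\<dots> = (LINT y|?P. (LINT t|?P. of_real (?W t) * wave d x t * cnj (g y * wave d y t)))"
    proof (intro Fubini_integral Bochner_Integration.integrable_bound[OF pI])
      show "(\<lambda>(y, t). of_real (?W t) * wave d x t * cnj (g y * wave d y t))
          \<in> borel_measurable (?P \<Otimes>\<^sub>M ?P)"
        by measurable
    qed (auto simp: norm_mult)
    also have "\<dots> = (LINT y|?P. cnj (g y) *
        (LINT t|?P. exp (- \<i> * of_real (\<Sum>i<d. (x i - y i) * t i)) * of_real (?W t)))"
      unfolding wave_cnj_mult [symmetric]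
      by (simp add: mult_ac flip: integral_mult_right_zero)
    also have "\<dots> = (LINT y|?P. cnj (g y) * of_real ((2 * pi) ^ d * ?N x y))"
      by (simp only: gaussian_fourier[OF e] gauss_kernel_def)
    finally show ?thesis .
  qed

  have iW: "integrable ?P (\<lambda>t. ?W t * (norm (I t))\<^sup>2)"
    by (rule Bochner_Integration.integrable_bound[of _ "\<lambda>t. ?W t * C\<^sup>2"])
       (use W C C0 in \<open>auto simp: abs_mult intro!: mult_left_mono power_mono\<close>)
  \<comment> \<open>The square is written as I times its conjugate. Only the first factor is
    expanded into an integral over x, so that after Fubini the inner integral over t is the one
    computed in \<open>inner\<close>.\<close>
  have "complex_of_real (LINT t|?P. ?W t * (norm (I t))\<^sup>2)
      = (LINT t|?P. of_real (?W t) * (I t * cnj (I t)))"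
    by (simp flip: integral_complex_of_real complex_norm_square)
  also have "\<dots> = (LINT t|?P. (LINT x|?P. g x * (of_real (?W t) * wave d x t * cnj (I t))))"
  proof (intro Bochner_Integration.integral_cong refl)
    fix t
    have "of_real (?W t) * (I t * cnj (I t)) = (LINT x|?P. g x * wave d x t) * (of_real (?W t) * cnj (I t))"
      by (simp add: I_def)
    also have "\<dots> = (LINT x|?P. g x * wave d x t * (of_real (?W t) * cnj (I t)))"
      by (simp only: integral_mult_left_zero)
    finally show "of_real (?W t) * (I t * cnj (I t))
        = (LINT x|?P. g x * (of_real (?W t) * wave d x t * cnj (I t)))"
      by (simp add: mult_ac)
  qed
  also have "\<dots> = (LINT x|?P. (LINT t|?P. g x * (of_real (?W t) * wave d x t * cnj (I t))))"
  proof (rule Fubini_integral, rule Bochner_Integration.integrable_bound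
      [where f = "\<lambda>z. C * (case z of (x, t) \<Rightarrow> norm (g x) * ?W t)"], goal_cases)
    case 1
    show ?case using pI by simp
  next
    case 2
    show ?case by measurable
  next
    case 3
    have "norm (case z of (x, t) \<Rightarrow> g x * (of_real (?W t) * wave d x t * cnj (I t)))
        \<le> norm (C * (case z of (x, t) \<Rightarrow> norm (g x) * ?W t))" for z
      using mult_left_mono[OF C[of "snd z"], of "norm (g (fst z)) * ?W (snd z)"] C0
      by (auto simp: norm_mult abs_mult mult_ac split: prod.split)
    then show ?case by simp
  qed
  also have "\<dots> = (LINT x|?P. g x * (LINT y|?P. cnj (g y) * of_real ((2 * pi) ^ d * ?N x y)))"
    by (simp only: integral_mult_right_zero inner)
  finally have eq: "complex_of_real (LINT t|?P. ?W t * (norm (I t))\<^sup>2)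
      = (LINT x|?P. g x * (LINT y|?P. cnj (g y) * of_real ((2 * pi) ^ d * ?N x y)))" .

  let ?h = "\<lambda>x. ennreal ((norm (g x))\<^sup>2)"
  have marg: "(\<integral>\<^sup>+x. \<integral>\<^sup>+y. f x * ennreal (?N x y) \<partial>?P \<partial>?P) = (\<integral>\<^sup>+x. f x \<partial>?P)"
    if [measurable]: "f \<in> borel_measurable ?P" for f :: "_ \<Rightarrow> ennreal"
    by (simp add: nn_integral_cmult nn_integral_gauss_kernel[OF e])
  \<comment> \<open>The kernel is symmetric, so after Fubini this is the same marginal as in
    \<open>marg\<close>.\<close>
  have marg2: "(\<integral>\<^sup>+x. \<integral>\<^sup>+y. ?h y * ennreal (?N x y) \<partial>?P \<partial>?P) = (\<integral>\<^sup>+x. ?h x \<partial>?P)"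
    by (subst Fubini') (simp_all add: marg gauss_kernel_commute[of d e _])
  have "ennreal (LINT t|?P. ?W t * (norm (I t))\<^sup>2)
      = ennreal (norm (complex_of_real (LINT t|?P. ?W t * (norm (I t))\<^sup>2)))"
    by (simp add: abs_of_nonneg integral_nonneg)
  also have "\<dots> \<le> (\<integral>\<^sup>+x. ennreal (norm (g x * (LINT y|?P. cnj (g y) * of_real ((2 * pi) ^ d * ?N x y)))) \<partial>?P)"
    unfolding eq by (rule norm_integral_le_nn_integral)
  also have "\<dots> = (\<integral>\<^sup>+x. ennreal (norm (g x)) *
      ennreal (norm (LINT y|?P. cnj (g y) * of_real ((2 * pi) ^ d * ?N x y))) \<partial>?P)"
    by (simp add: norm_mult ennreal_mult)
  also have "\<dots> \<le> (\<integral>\<^sup>+x. ennreal (norm (g x)) *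
      (\<integral>\<^sup>+y. ennreal (norm (cnj (g y) * of_real ((2 * pi) ^ d * ?N x y))) \<partial>?P) \<partial>?P)"
    by (intro nn_integral_mono mult_left_mono norm_integral_le_nn_integral) auto
  also have "\<dots> = (\<integral>\<^sup>+x. \<integral>\<^sup>+y. ennreal ((2 * pi) ^ d * (norm (g x) * norm (g y) * ?N x y)) \<partial>?P \<partial>?P)"
    by (subst nn_integral_cmult [symmetric])
       (auto simp: norm_mult norm_power abs_mult mult_ac simp flip: ennreal_mult intro!: nn_integral_cong)
  also have "\<dots> \<le> (\<integral>\<^sup>+x. \<integral>\<^sup>+y. ennreal ((2 * pi) ^ d / 2) *
      (?h x * ennreal (?N x y) + ?h y * ennreal (?N x y)) \<partial>?P \<partial>?P)"
  proof (intro nn_integral_mono)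
    fix x y
    have "norm (g x) * norm (g y) \<le> ((norm (g x))\<^sup>2 + (norm (g y))\<^sup>2) / 2"
      using sum_squares_bound[of "norm (g x)" "norm (g y)"] by simp
    then have "(2 * pi) ^ d * (norm (g x) * norm (g y) * ?N x y)
        \<le> (2 * pi) ^ d * (((norm (g x))\<^sup>2 + (norm (g y))\<^sup>2) / 2 * ?N x y)"
      by (intro mult_left_mono mult_right_mono) auto
    also have "\<dots> = (2 * pi) ^ d / 2 * ((norm (g x))\<^sup>2 * ?N x y + (norm (g y))\<^sup>2 * ?N x y)"
      by (simp add: field_simps)
    finally show "ennreal ((2 * pi) ^ d * (norm (g x) * norm (g y) * ?N x y))
        \<le> ennreal ((2 * pi) ^ d / 2) * (?h x * ennreal (?N x y) + ?h y * ennreal (?N x y))"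
      by (simp flip: ennreal_mult ennreal_plus)
  qed
  \<comment> \<open>Both marginals of the kernel are 1, so each of the two halves contributes the
    squared norm of \<open>g\<close> once.\<close>
  also have "\<dots> = ennreal ((2 * pi) ^ d / 2) * ((\<integral>\<^sup>+x. ?h x \<partial>?P) + (\<integral>\<^sup>+x. ?h x \<partial>?P))"
    by (simp add: nn_integral_cmult nn_integral_add marg2 nn_integral_gauss_kernel[OF e]
        sigma_finite_measure.borel_measurable_nn_integral[OF sigma_finite_lborel_d])
  also have "\<dots> = ennreal ((2 * pi) ^ d) * (\<integral>\<^sup>+x. ?h x \<partial>?P)"
    by (simp add: mult_2 [symmetric] mult.assoc [symmetric] flip: ennreal_numeral ennreal_mult)
  finally have main: "ennreal (LINT t|?P. ?W t * (norm (I t))\<^sup>2) \<le> ennreal ((2 * pi) ^ d) * (\<integral>\<^sup>+x. ?h x \<partial>?P)" .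

  \<comment> \<open>The squared normalisation of \<open>fourier\<close>, which cancels the (2 pi)^d
    coming from \<open>gaussian_fourier\<close>.\<close>
  have pw: "((2 * pi) powr (- real d / 2))\<^sup>2 = inverse ((2 * pi) ^ d)"
  proof -
    have "((2 * pi) powr (- real d / 2))\<^sup>2 = (2 * pi) powr (- real d)"
      by (simp add: power2_eq_square flip: powr_add)
    then show ?thesis
      by (simp add: powr_minus powr_realpow)
  qed
  have "(\<integral>\<^sup>+t. ennreal (?W t * (norm (fourier d g t))\<^sup>2) \<partial>?P)
      = (\<integral>\<^sup>+t. ennreal (inverse ((2 * pi) ^ d)) * ennreal (?W t * (norm (I t))\<^sup>2) \<partial>?P)"
    unfolding fourier_def I_def [symmetric]
    by (intro nn_integral_cong)
       (use pw in \<open>simp add: norm_mult power_mult_distrib mult.left_commute flip: ennreal_mult\<close>)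
  also have "\<dots> = ennreal (inverse ((2 * pi) ^ d)) * ennreal (LINT t|?P. ?W t * (norm (I t))\<^sup>2)"
    by (subst nn_integral_cmult) (auto simp: nn_integral_eq_integral[OF iW])
  also have "\<dots> \<le> ennreal (inverse ((2 * pi) ^ d)) * (ennreal ((2 * pi) ^ d) * (\<integral>\<^sup>+x. ?h x \<partial>?P))"
    by (intro mult_left_mono main) auto
  also have "\<dots> = (\<integral>\<^sup>+x. ?h x \<partial>?P)"
    by (simp add: mult.assoc [symmetric] flip: ennreal_mult) (simp add: field_simps)
  finally show ?thesis .
qed

text \<open>The weighted bound is uniform in the width. With e = 1/(n+1) the weight tends to 1
  pointwise, and Fatou's lemma carries the bound to the limit.\<close>

lemma bessel:
  assumes g: "integrable (lborel_d d) g"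
  shows "(\<integral>\<^sup>+t. ennreal ((norm (fourier d g t))\<^sup>2) \<partial>lborel_d d)
    \<le> (\<integral>\<^sup>+x. ennreal ((norm (g x))\<^sup>2) \<partial>lborel_d d)"
proof -
  let ?P = "lborel_d d" and ?e = "\<lambda>n. inverse (real (Suc n))"
  have [measurable]: "g \<in> borel_measurable ?P"
    using g by auto
  have lim: "(\<lambda>n. ennreal (gauss_weight d (?e n) t * (norm (fourier d g t))\<^sup>2))
      \<longlonglongrightarrow> ennreal ((norm (fourier d g t))\<^sup>2)" for t
  proof -
    have "(\<lambda>n. gauss_weight d (?e n) t) \<longlonglongrightarrow> (\<Prod>i<d. exp (- (0 * t i)\<^sup>2 / 2))"
      unfolding gauss_weight_def by (intro tendsto_intros LIMSEQ_inverse_real_of_nat) auto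
    then have "(\<lambda>n. gauss_weight d (?e n) t * (norm (fourier d g t))\<^sup>2)
        \<longlonglongrightarrow> 1 * (norm (fourier d g t))\<^sup>2"
      by (intro tendsto_mult) auto
    then show ?thesis
      by (intro tendsto_ennrealI) simp
  qed
  have "(\<integral>\<^sup>+t. ennreal ((norm (fourier d g t))\<^sup>2) \<partial>?P)
      = (\<integral>\<^sup>+t. liminf (\<lambda>n. ennreal (gauss_weight d (?e n) t * (norm (fourier d g t))\<^sup>2)) \<partial>?P)"
    by (intro nn_integral_cong lim_imp_Liminf[OF _ lim, symmetric]) simp
  also have "\<dots> \<le> liminf (\<lambda>n. \<integral>\<^sup>+t. ennreal (gauss_weight d (?e n) t * (norm (fourier d g t))\<^sup>2) \<partial>?P)"
    by (rule nn_integral_liminf) measurable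
  also have "\<dots> \<le> (\<integral>\<^sup>+x. ennreal ((norm (g x))\<^sup>2) \<partial>?P)"
    using gauss_weighted_bessel[OF _ g] by (intro Liminf_le) auto
  finally show ?thesis .
qed

section \<open>Differentiation of the Fourier transform and the bump function\<close>

text \<open>Both differentiations under an integral sign, in the Fourier transform and in the
  convolution, are reduced to such a global quadratic remainder.\<close>

lemma has_vector_derivative_quadratic:
  fixes f :: "real \<Rightarrow> 'a::real_normed_vector"
  assumes "\<And>h. norm (f (s + h) - f s - h *\<^sub>R D) \<le> C * h\<^sup>2"
  shows "(f has_vector_derivative D) (at s)"
  unfolding has_vector_derivative_def has_derivative_at
proof
  show "bounded_linear (\<lambda>h. h *\<^sub>R D)"
    by (rule bounded_linear_scaleR_left)
  show "(\<lambda>h. norm (f (s + h) - f s - h *\<^sub>R D) / norm h) \<midarrow>0\<rightarrow> 0"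
  proof (rule real_tendsto_sandwich[of "\<lambda>_. 0" _ _ "\<lambda>h. C * \<bar>h\<bar>"])
    show "\<forall>\<^sub>F h in at 0. norm (f (s + h) - f s - h *\<^sub>R D) / norm h \<le> C * \<bar>h\<bar>"
      using assms
      by (intro eventually_at_filter[THEN iffD2] always_eventually)
         (auto simp: divide_le_eq power2_eq_square abs_mult mult.assoc simp flip: abs_mult)
    have "(\<lambda>h. C * \<bar>h\<bar>) \<midarrow>0\<rightarrow> C * \<bar>0\<bar>"
      by (intro tendsto_intros)
    then show "(\<lambda>h. C * \<bar>h\<bar>) \<midarrow>0\<rightarrow> 0" by simp
  qed auto
qed

lemma wave_upd:
  assumes "i < d"
  shows "wave d x (t(i := s + h)) = wave d x (t(i := s)) * iexp (- (h * x i))"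
proof -
  have "(\<Sum>j<d. x j * (t(i := s + h)) j) = (\<Sum>j<d. x j * (t(i := s)) j + (if j = i then h * x i else 0))"
    by (intro sum.cong) (auto simp: algebra_simps)
  also have "\<dots> = (\<Sum>j<d. x j * (t(i := s)) j) + h * x i"
    using assms by (simp add: sum.distrib)
  finally show ?thesis
    by (simp add: wave_def exp_add [symmetric] algebra_simps)
qed

text \<open>On the support of \<open>g\<close> the frequency factor |x i| is at most 1, so the
  Taylor remainder of the exponential is at most h^2 uniformly in x. The remainder of the transform
  is then at most h^2 times a multiple of the L^1 norm of \<open>g\<close>.\<close>

lemma has_vector_derivative_fourier:
  assumes g: "integrable (lborel_d d) g" and supp: "\<And>x. g x \<noteq> 0 \<Longrightarrow> \<bar>x i\<bar> \<le> 1" and i: "i < d"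
  shows "((\<lambda>s. fourier d g (t(i := s))) has_vector_derivative
      fourier d (\<lambda>x. - \<i> * of_real (x i) * g x) (t(i := s))) (at s)"
proof (rule has_vector_derivative_quadratic)
  fix h :: real
  let ?P = "lborel_d d" and ?k = "(2 * pi) powr (- real d / 2)"
  let ?w = "\<lambda>x. wave d x (t(i := s))"
  \<comment> \<open>The remainder of exp(-i h x_i) after its terms of order 0 and 1; those two terms
    account for the value and the derivative.\<close>
  let ?r = "\<lambda>x. iexp (- (h * x i)) - (\<Sum>k\<le>1. (\<i> * complex_of_real (- (h * x i))) ^ k / fact k)"
  have [measurable]: "g \<in> borel_measurable ?P" "(\<lambda>x. x i) \<in> borel_measurable ?P"
    using g i by auto
  have b: "norm (of_real (x i) * g x) \<le> norm (g x)" for x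
    using supp[of x] by (cases "g x = 0") (auto simp: norm_mult intro: mult_left_le_one_le)
  have i1: "integrable ?P (\<lambda>x. g x * wave d x u)" for u
    by (rule Bochner_Integration.integrable_bound[OF g]) (auto simp: norm_mult)
  have i2: "integrable ?P (\<lambda>x. - \<i> * of_real (x i) * g x * wave d x u)" for u
    by (rule Bochner_Integration.integrable_bound[OF g]) (use b in \<open>auto simp: norm_mult\<close>)
  have "(LINT x|?P. g x * wave d x (t(i := s + h))) - (LINT x|?P. g x * ?w x)
      - h *\<^sub>R (LINT x|?P. - \<i> * of_real (x i) * g x * ?w x)
    = (LINT x|?P. g x * wave d x (t(i := s + h)) - g x * ?w x
        - h *\<^sub>R (- \<i> * of_real (x i) * g x * ?w x))"
    using i1 i2
    by (simp only: Bochner_Integration.integral_diff Bochner_Integration.integrable_diff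
        integral_scaleR_right integrable_scaleR_right)
  also have "\<dots> = (LINT x|?P. g x * ?w x * ?r x)"
    by (intro Bochner_Integration.integral_cong refl)
       (simp only: wave_upd[OF i, of _ t s h], simp add: scaleR_conv_of_real algebra_simps)
  finally have eq0: "(LINT x|?P. g x * wave d x (t(i := s + h))) - (LINT x|?P. g x * ?w x)
      - h *\<^sub>R (LINT x|?P. - \<i> * of_real (x i) * g x * ?w x)
    = (LINT x|?P. g x * ?w x * ?r x)" .
  have eq: "fourier d g (t(i := s + h)) - fourier d g (t(i := s)) -
      h *\<^sub>R fourier d (\<lambda>x. - \<i> * of_real (x i) * g x) (t(i := s))
    = of_real ?k * (LINT x|?P. g x * ?w x * ?r x)"
    unfolding fourier_def eq0 [symmetric] by (simp only: right_diff_distrib mult_scaleR_right)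
  have "norm (LINT x|?P. g x * ?w x * ?r x) \<le> (LINT x|?P. norm (g x) * h\<^sup>2)"
  proof (rule order_trans[OF integral_norm_bound integral_mono])
    show int: "integrable ?P (\<lambda>x. norm (g x) * h\<^sup>2)"
      using g by simp
    show le: "norm (g x * ?w x * ?r x) \<le> norm (g x) * h\<^sup>2" for x
    proof (cases "g x = 0")
      case False
      have "norm (?r x) \<le> \<bar>- (h * x i)\<bar> ^ Suc 1 / fact (Suc 1)"
        by (rule iexp_approx1)
      also have "\<dots> \<le> h\<^sup>2 * \<bar>x i\<bar>\<^sup>2"
        using zero_le_power2[of "h * x i"] by (simp add: power_mult_distrib power2_eq_square mult_ac)
      also have "\<dots> \<le> h\<^sup>2 * 1"
        using supp[OF False] by (intro mult_left_mono) (auto simp: abs_square_le_1)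
      finally show ?thesis
        by (simp only: norm_mult norm_wave mult_1_right) (intro mult_left_mono, auto)
    qed simp
    show "integrable ?P (\<lambda>x. norm (g x * ?w x * ?r x))"
      by (rule Bochner_Integration.integrable_bound[OF int]) (use le in auto)
  qed
  then show "norm (fourier d g (t(i := s + h)) - fourier d g (t(i := s)) -
      h *\<^sub>R fourier d (\<lambda>x. - \<i> * of_real (x i) * g x) (t(i := s)))
    \<le> (?k * (LINT x|?P. norm (g x))) * h\<^sup>2"
    unfolding eq by (simp add: norm_mult mult.assoc)
qed

section \<open>The bump function: support, integrability, normalisation\<close>

lemma bump_with_measurable [measurable]: "bump_with d C \<in> borel_measurable (lborel_d d)"
  unfolding bump_with_def L2_set_def by measurable

text \<open>Makes the normalisation condition linear in C, so that it has exactly one positive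
  solution.\<close>

lemma bump_with_sqr: "0 \<le> C \<Longrightarrow> \<bar>bump_with d C x\<bar>\<^sup>2 = C * \<bar>bump_with d 1 x\<bar>\<^sup>2"
  by (simp add: bump_with_def power_mult_distrib)

lemma bump_with_1_bounds: "0 \<le> bump_with d 1 x" "bump_with d 1 x \<le> 1"
  by (auto simp: bump_with_def L2_set_nonneg power_le_one)

lemma bump_with_nonzeroD:
  assumes "bump_with d C x \<noteq> 0"
  shows "(\<Sum>i<d. (x i)\<^sup>2) \<le> 1" and "i < d \<Longrightarrow> \<bar>x i\<bar> \<le> 1"
proof -
  have *: "L2_set x {..<d} < 1"
    using assms by (auto simp: bump_with_def split: if_splits)
  then show "(\<Sum>i<d. (x i)\<^sup>2) \<le> 1"
    by (simp add: L2_set_def)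
  show "\<bar>x i\<bar> \<le> 1" if "i < d"
  proof -
    have "(x i)\<^sup>2 \<le> (\<Sum>i<d. (x i)\<^sup>2)"
      using that by (intro member_le_sum) auto
    with \<open>(\<Sum>i<d. (x i)\<^sup>2) \<le> 1\<close> show ?thesis
      by (simp flip: abs_square_le_1)
  qed
qed

lemma emeasure_cube:
  assumes "0 \<le> r"
  shows "Pi\<^sub>E {..<d} (\<lambda>_. {-r..r}) \<in> sets (lborel_d d)"
    and "emeasure (lborel_d d) (Pi\<^sub>E {..<d} (\<lambda>_. {-r..r})) = ennreal ((2 * r) ^ d)"
proof -
  interpret product_sigma_finite "\<lambda>_::nat. lborel :: real measure" ..
  show "Pi\<^sub>E {..<d} (\<lambda>_. {-r..r}) \<in> sets (lborel_d d)"
    by (auto intro!: sets_PiM_I_finite)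
  show "emeasure (lborel_d d) (Pi\<^sub>E {..<d} (\<lambda>_. {-r..r})) = ennreal ((2 * r) ^ d)"
    using assms by (subst emeasure_PiM) (auto simp: ennreal_power)
qed

text \<open>A multiple of the indicator of the cube [-1,1]^d, which has finite measure 2^d, is an
  integrable majorant.\<close>

lemma integrable_cube_bound:
  fixes g :: "(nat \<Rightarrow> real) \<Rightarrow> 'a::{banach, second_countable_topology}"
  assumes [measurable]: "g \<in> borel_measurable (lborel_d d)"
    and B: "\<And>x. norm (g x) \<le> B" and supp: "\<And>x i. g x \<noteq> 0 \<Longrightarrow> i < d \<Longrightarrow> \<bar>x i\<bar> \<le> 1"
  shows "integrable (lborel_d d) g"
proof (rule Bochner_Integration.integrable_bound)
  let ?Q = "Pi\<^sub>E {..<d} (\<lambda>_. {-1..1}) :: (nat \<Rightarrow> real) set"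
  have "emeasure (lborel_d d) ?Q < \<infinity>"
    using emeasure_cube(2)[of 1 d] by simp
  then show "integrable (lborel_d d) (\<lambda>x. indicator ?Q x * B)"
    using emeasure_cube(1)[of 1 d] by (intro integrable_mult_left integrable_real_indicator) auto
  have "0 \<le> B" using B[of undefined] norm_ge_zero order_trans by blast
  then show "AE x in lborel_d d. norm (g x) \<le> norm (indicator ?Q x * B)"
  proof (intro AE_I2)
    fix x assume x: "x \<in> space (lborel_d d)"
    show "norm (g x) \<le> norm (indicator ?Q x * B)"
    proof (cases "g x = 0")
      case False
      then have "x \<in> ?Q"
        using supp[OF False] x by (auto simp: space_PiM PiE_def Pi_def abs_le_iff minus_le_iff)
      then show ?thesis using B[of x] by auto
    qed simp
  qed
qed simp

text \<open>For C = 1 the squared integral \<open>I\<close> is finite and positive, hence 1/I is the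
  unique number that the definite description in \<open>bump_const\<close> can denote.\<close>

lemma bump_const_pos: "0 < bump_const d"
  and nn_integral_bump_sqr: "(\<integral>\<^sup>+x. ennreal ((bump d x)\<^sup>2) \<partial>lborel_d d) = 1"
proof -
  let ?P = "lborel_d d"
  define I where "I = (LINT x|?P. \<bar>bump_with d 1 x\<bar>\<^sup>2)"
  have int: "integrable ?P (\<lambda>x. \<bar>bump_with d 1 x\<bar>\<^sup>2)"
    by (rule integrable_cube_bound[where B = 1])
       (use bump_with_1_bounds bump_with_nonzeroD(2) in \<open>auto simp: power_le_one_iff\<close>)
  \<comment> \<open>On the cube of half-width r the sum of the |x i|, and hence the Euclidean norm,
    is at most 1/2. There the bump with C = 1 is at least 3/4, with square at least 9/16. The added
    1 keeps r positive for d = 0.\<close>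
  define r where "r = 1 / (2 * (real d + 1))"
  have r: "0 < r" "real d * r \<le> 1/2"
    by (auto simp: r_def field_simps)
  let ?q = "Pi\<^sub>E {..<d} (\<lambda>_. {-r..r})"
  have q: "?q \<in> sets ?P" "emeasure ?P ?q = ennreal ((2 * r) ^ d)"
    using emeasure_cube[of r d] r by auto
  have "0 < measure ?P ?q * (9/16)"
    using q r by (simp add: measure_def)
  also have "\<dots> = (LINT x|?P. indicator ?q x * (9/16))"
    using q by simp
  also have "\<dots> \<le> I"
    unfolding I_def
  proof (rule integral_mono)
    show "integrable ?P (\<lambda>x. indicator ?q x * (9/16 :: real))"
      using q by (intro integrable_mult_left integrable_real_indicator) auto
    fix x
    show "indicator ?q x * (9/16 :: real) \<le> \<bar>bump_with d 1 x\<bar>\<^sup>2"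
    proof (cases "x \<in> ?q")
      case True
      then have "\<bar>x i\<bar> \<le> r" if "i < d" for i
        using that by (auto simp: PiE_def Pi_def abs_le_iff minus_le_iff)
      then have "(\<Sum>i<d. \<bar>x i\<bar>) \<le> real d * r"
        using sum_bounded_above[of "{..<d}" "\<lambda>i. \<bar>x i\<bar>" r] by simp
      then have L: "L2_set x {..<d} \<le> 1/2"
        using r L2_set_le_sum_abs[of x "{..<d}"] by linarith
      then have "(L2_set x {..<d})\<^sup>2 \<le> (1/2)\<^sup>2"
        by (intro power_mono L2_set_nonneg)
      then have "3/4 \<le> bump_with d 1 x"
        using L by (simp add: bump_with_def power2_eq_square)
      then have "(3/4)\<^sup>2 \<le> (bump_with d 1 x)\<^sup>2"
        by (intro power_mono) auto
      then show ?thesis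
        using True by (simp add: power2_eq_square)
    qed simp
  qed (rule int)
  finally have I: "0 < I" .
  have sq: "(LINT x|lebesgue_d d. \<bar>bump_with d C x\<bar>\<^sup>2) = C * I" if "0 \<le> C" for C
    unfolding lebesgue_d_def I_def
    by (subst integral_completion) (auto simp: bump_with_sqr[OF that] simp del: power2_abs)
  have c: "bump_const d = 1 / I"
    unfolding bump_const_def
  proof (rule the_equality)
    show "0 < 1 / I \<and> sqrt (LINT x|lebesgue_d d. \<bar>bump_with d (1 / I) x\<bar>\<^sup>2) = 1"
      using I by (subst sq) auto
    show "C = 1 / I" if "0 < C \<and> sqrt (LINT x|lebesgue_d d. \<bar>bump_with d C x\<bar>\<^sup>2) = 1" for C
      using that I sq[of C] by (auto simp: real_sqrt_eq_1_iff field_simps)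
  qed
  then show pos: "0 < bump_const d"
    using I by simp
  have "(\<integral>\<^sup>+x. ennreal ((bump d x)\<^sup>2) \<partial>?P)
      = (\<integral>\<^sup>+x. ennreal (bump_const d * \<bar>bump_with d 1 x\<bar>\<^sup>2) \<partial>?P)"
    using bump_with_sqr[of "bump_const d" d] pos by (simp add: bump_def)
  also have "\<dots> = ennreal (LINT x|?P. bump_const d * \<bar>bump_with d 1 x\<bar>\<^sup>2)"
    using int pos by (intro nn_integral_eq_integral) auto
  also have "(LINT x|?P. bump_const d * \<bar>bump_with d 1 x\<bar>\<^sup>2) = 1"
    using I by (subst integral_mult_right_zero) (simp only: I_def [symmetric] c, simp)
  finally show "(\<integral>\<^sup>+x. ennreal ((bump d x)\<^sup>2) \<partial>?P) = 1"
    by simp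
qed

section \<open>The derivatives of the kernel\<close>

text \<open>Induction over the variables: each step keeps the single term of the binomial expansion
  of (y a + s)^(k + m) in which y a has exponent k. All other terms are nonnegative.\<close>

lemma multinomial_term_le:
  fixes y :: "'a \<Rightarrow> real"
  assumes "finite A" "\<And>i. i \<in> A \<Longrightarrow> 0 \<le> y i"
  shows "fact (\<Sum>i\<in>A. m i) * (\<Prod>i\<in>A. y i ^ m i)
    \<le> (\<Prod>i\<in>A. fact (m i)) * (\<Sum>i\<in>A. y i) ^ (\<Sum>i\<in>A. m i)"
  using assms
proof (induction A rule: finite_induct)
  case (insert a A)
  let ?k = "m a" and ?m = "\<Sum>i\<in>A. m i" and ?s = "\<Sum>i\<in>A. y i"
  have y: "0 \<le> y a" "0 \<le> ?s"
    using insert.prems by (auto intro: sum_nonneg)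
  have "real ((?k + ?m) choose ?k) * y a ^ ?k * ?s ^ ((?k + ?m) - ?k)
      \<le> (\<Sum>j\<le>?k + ?m. real ((?k + ?m) choose j) * y a ^ j * ?s ^ ((?k + ?m) - j))"
    using y by (intro member_le_sum) auto
  also have "\<dots> = (y a + ?s) ^ (?k + ?m)"
    by (rule binomial_ring [symmetric])
  finally have b: "real ((?k + ?m) choose ?k) * y a ^ ?k * ?s ^ ?m \<le> (y a + ?s) ^ (?k + ?m)"
    by simp
  have f: "(fact (?k + ?m) :: real) = fact ?k * fact ?m * real ((?k + ?m) choose ?k)"
    using arg_cong[OF binomial_fact_lemma[of ?k "?k + ?m"], of real] by (simp add: mult_ac)
  have "fact (?k + ?m) * (y a ^ ?k * (\<Prod>i\<in>A. y i ^ m i))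
      = fact ?k * real ((?k + ?m) choose ?k) * y a ^ ?k * (fact ?m * (\<Prod>i\<in>A. y i ^ m i))"
    by (simp add: f mult_ac)
  also have "\<dots> \<le> fact ?k * real ((?k + ?m) choose ?k) * y a ^ ?k * ((\<Prod>i\<in>A. fact (m i)) * ?s ^ ?m)"
    using insert y by (intro mult_left_mono insert.IH) auto
  also have "\<dots> = fact ?k * (\<Prod>i\<in>A. fact (m i)) * (real ((?k + ?m) choose ?k) * y a ^ ?k * ?s ^ ?m)"
    by (simp add: mult_ac)
  also have "\<dots> \<le> fact ?k * (\<Prod>i\<in>A. fact (m i)) * (y a + ?s) ^ (?k + ?m)"
    using b by (intro mult_left_mono) (auto intro!: mult_nonneg_nonneg prod_nonneg)
  finally show ?case
    using insert.hyps by simp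
qed simp

lemma prod_list_map_eq_prod_count:
  fixes f :: "'a \<Rightarrow> 'b::comm_monoid_mult"
  assumes "finite A" "set xs \<subseteq> A"
  shows "prod_list (map f xs) = (\<Prod>i\<in>A. f i ^ count_list xs i)"
  using assms(2)
proof (induction xs)
  case (Cons x xs)
  have "(\<Prod>i\<in>A. f i ^ count_list (x # xs) i)
      = (\<Prod>i\<in>A. (if i = x then f i else 1) * f i ^ count_list xs i)"
    by (intro prod.cong) auto
  also have "\<dots> = f x * (\<Prod>i\<in>A. f i ^ count_list xs i)"
    using Cons.prems assms(1) by (simp add: prod.distrib)
  finally show ?case using Cons by simp
qed simp

text \<open>The factorial of the multi-index whose i-th entry is the multiplicity of i in the
  list.\<close>

definition list_fact :: "nat \<Rightarrow> nat list \<Rightarrow> nat" where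
  "list_fact d xs = (\<Prod>i<d. fact (count_list xs i))"

text \<open>The multinomial bound with multiplicities as exponents; these add up to the length. It
  is applied to y i = (x i)^2 on the unit ball.\<close>

lemma prod_list_le_list_fact:
  fixes y :: "nat \<Rightarrow> real"
  assumes "set xs \<subseteq> {..<d}" and y: "\<And>i. i < d \<Longrightarrow> 0 \<le> y i" "(\<Sum>i<d. y i) \<le> 1"
  shows "prod_list (map y xs) \<le> list_fact d xs / fact (length xs)"
proof -
  have len: "(\<Sum>i<d. count_list xs i) = length xs"
    using assms(1) by (intro sum_count_set) auto
  have "fact (length xs) * prod_list (map y xs)
      = fact (\<Sum>i<d. count_list xs i) * (\<Prod>i<d. y i ^ count_list xs i)"
    using assms(1) by (simp add: len prod_list_map_eq_prod_count[of "{..<d}"])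
  also have "\<dots> \<le> (\<Prod>i<d. fact (count_list xs i)) * (\<Sum>i<d. y i) ^ (\<Sum>i<d. count_list xs i)"
    using y(1) by (intro multinomial_term_le) auto
  also have "\<dots> \<le> (\<Prod>i<d. fact (count_list xs i)) * 1"
    using y by (intro mult_left_mono power_le_one sum_nonneg prod_nonneg) auto
  finally show ?thesis
    by (simp add: list_fact_def field_simps)
qed

section \<open>Leibniz terms as splittings of a list\<close>

text \<open>One entry for each term of the Leibniz rule for two factors: every differentiation hits
  either the first or the second. Repeated terms stand in for binomial coefficients.\<close>

primrec splits :: "'a list \<Rightarrow> ('a list \<times> 'a list) list" where
  "splits [] = [([], [])]"
| "splits (x # xs) = map (\<lambda>(a, b). (x # a, b)) (splits xs) @ map (\<lambda>(a, b). (a, x # b)) (splits xs)"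

lemma length_splits: "length (splits xs) = 2 ^ length xs"
  by (induction xs) auto

lemma splits_length: "(a, b) \<in> set (splits xs) \<Longrightarrow> length a + length b = length xs"
  by (induction xs arbitrary: a b) auto

lemma splits_count: "(a, b) \<in> set (splits xs) \<Longrightarrow> count_list a i + count_list b i = count_list xs i"
  by (induction xs arbitrary: a b) auto

lemma splits_subset: "(a, b) \<in> set (splits xs) \<Longrightarrow> set a \<subseteq> set xs \<and> set b \<subseteq> set xs"
  by (induction xs arbitrary: a b) (auto, fastforce+)

text \<open>Two estimates are multiplied. In each coordinate p! q! <= (p+q)!, which handles the
  numerators; for the lengths, n! <= 2^n p! q! because a binomial coefficient is at most 2^n. The
  latter is the source of the 2^n under the root.\<close>

lemma splits_fact_le:
  assumes "(a, b) \<in> set (splits xs)"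
  shows "(list_fact d a / fact (length a)) * (list_fact d b / fact (length b))
    \<le> 2 ^ length xs * list_fact d xs / fact (length xs)"
proof -
  have "fact (count_list a i) * fact (count_list b i) \<le> (fact (count_list xs i) :: nat)" for i
    using fact_fact_dvd_fact[of "count_list a i" "count_list b i", where ?'a = nat]
      splits_count[OF assms, of i]
    by (auto intro: dvd_imp_le)
  then have 1: "list_fact d a * list_fact d b \<le> list_fact d xs"
    unfolding list_fact_def by (auto simp flip: prod.distrib intro: prod_mono)
  have len: "length a \<le> length xs" "length xs - length a = length b"
    using splits_length[OF assms] by auto
  have "fact (length xs) = fact (length a) * fact (length b) * real (length xs choose length a)"
    using arg_cong[OF binomial_fact_lemma[OF len(1)], of real] len(2) by (simp add: mult_ac)
  also have "\<dots> \<le> fact (length a) * fact (length b) * 2 ^ length xs"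
    using of_nat_mono[OF binomial_le_pow2[of "length xs" "length a"], where ?'a = real]
    by (intro mult_left_mono) auto
  finally have 2: "1 / (fact (length a) * fact (length b)) \<le> 2 ^ length xs / (fact (length xs) :: real)"
    by (simp add: field_simps)
  have "(list_fact d a / fact (length a)) * (list_fact d b / fact (length b))
      = real (list_fact d a * list_fact d b) * (1 / (fact (length a) * fact (length b)))"
    by simp
  also have "\<dots> \<le> real (list_fact d xs) * (2 ^ length xs / fact (length xs))"
    using of_nat_mono[OF 1, where ?'a = real] 2 by (intro mult_mono) auto
  finally show ?thesis by (simp add: mult_ac)
qed

section \<open>Derivatives of the transform of the bump\<close>

text \<open>Its Fourier transform is the derivative of \<open>bump_hat\<close> along the list: each
  differentiation brings down one factor -i x_i.\<close>

definition bump_monomial :: "nat \<Rightarrow> nat list \<Rightarrow> (nat \<Rightarrow> real) \<Rightarrow> complex" where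
  "bump_monomial d a x = prod_list (map (\<lambda>i. - \<i> * of_real (x i)) a) * of_real (bump d x)"

lemma bump_monomial_Cons:
  "bump_monomial d (i # a) = (\<lambda>x. - \<i> * of_real (x i) * bump_monomial d a x)"
  by (simp add: bump_monomial_def fun_eq_iff)

lemma bump_monomial_measurable [measurable]:
  assumes "set a \<subseteq> {..<d}"
  shows "bump_monomial d a \<in> borel_measurable (lborel_d d)"
  using assms
proof (induction a)
  case Nil
  then show ?case unfolding bump_monomial_def bump_def by simp
next
  case (Cons i a)
  have [measurable]: "(\<lambda>x. x i) \<in> borel_measurable (lborel_d d)"
    using Cons.prems by auto
  have [measurable]: "bump_monomial d a \<in> borel_measurable (lborel_d d)"
    using Cons by auto
  show ?case unfolding bump_monomial_Cons by measurable
qed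

lemma bump_monomial_support:
  assumes "bump_monomial d a x \<noteq> 0"
  shows "(\<Sum>i<d. (x i)\<^sup>2) \<le> 1" and "i < d \<Longrightarrow> \<bar>x i\<bar> \<le> 1"
  using assms bump_with_nonzeroD[of d "bump_const d" x]
  by (auto simp: bump_monomial_def bump_def)

lemma norm_prod_list_map: "norm (prod_list (map f xs)) = prod_list (map (\<lambda>x. norm (f x)) xs)"
  for f :: "'a \<Rightarrow> 'b::real_normed_field"
  by (induction xs) (auto simp: norm_mult)

lemma prod_list_map_power: "prod_list (map f xs) ^ n = prod_list (map (\<lambda>x. f x ^ n) xs)"
  for f :: "'a \<Rightarrow> 'b::comm_monoid_mult"
  by (induction xs) (auto simp: power_mult_distrib)

text \<open>The factors have squared moduli (x i)^2, and on the support of the bump these sum to at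
  most 1, as the multinomial bound requires.\<close>

lemma norm_bump_monomial_sqr_le:
  assumes "set a \<subseteq> {..<d}"
  shows "(norm (bump_monomial d a x))\<^sup>2 \<le> list_fact d a / fact (length a) * (bump d x)\<^sup>2"
proof (cases "bump_monomial d a x = 0")
  case False
  have "(norm (bump_monomial d a x))\<^sup>2 = prod_list (map (\<lambda>i. (x i)\<^sup>2) a) * (bump d x)\<^sup>2"
    by (simp add: bump_monomial_def norm_mult norm_prod_list_map power_mult_distrib
        prod_list_map_power)
  also have "\<dots> \<le> list_fact d a / fact (length a) * (bump d x)\<^sup>2"
    using assms bump_monomial_support(1)[OF False]
    by (intro mult_right_mono prod_list_le_list_fact) auto
  finally show ?thesis .
qed auto

lemma bump_sqr_le: "(bump d x)\<^sup>2 \<le> bump_const d"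
proof -
  have "\<bar>bump_with d 1 x\<bar>\<^sup>2 \<le> 1"
    using bump_with_1_bounds[of d x] by (simp add: power_le_one)
  then have "bump_const d * \<bar>bump_with d 1 x\<bar>\<^sup>2 \<le> bump_const d * 1"
    using bump_const_pos[of d] by (intro mult_left_mono) auto
  then show ?thesis
    using bump_with_sqr[of "bump_const d" d x] bump_const_pos[of d] by (simp add: bump_def)
qed

lemma integrable_bump_monomial:
  assumes "set a \<subseteq> {..<d}"
  shows "integrable (lborel_d d) (bump_monomial d a)"
proof (rule integrable_cube_bound)
  show "bump_monomial d a \<in> borel_measurable (lborel_d d)"
    using assms by simp
  fix x
  have "(norm (bump_monomial d a x))\<^sup>2 \<le> list_fact d a / fact (length a) * bump_const d"
    by (intro order_trans[OF norm_bump_monomial_sqr_le[OF assms]] mult_left_mono bump_sqr_le) simp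
  then show "norm (bump_monomial d a x) \<le> sqrt (list_fact d a / fact (length a) * bump_const d)"
    by (rule real_le_rsqrt)
qed (rule bump_monomial_support)

definition bump_hat_deriv :: "nat \<Rightarrow> nat list \<Rightarrow> (nat \<Rightarrow> real) \<Rightarrow> complex" where
  "bump_hat_deriv d a = fourier d (bump_monomial d a)"

lemma bump_hat_deriv_measurable [measurable]:
  "set a \<subseteq> {..<d} \<Longrightarrow> bump_hat_deriv d a \<in> borel_measurable (lborel_d d)"
  unfolding bump_hat_deriv_def by measurable

lemma bump_hat_deriv_Nil: "bump_hat_deriv d [] = bump_hat d"
proof -
  have [measurable]: "bump d \<in> borel_measurable (lborel_d d)"
    unfolding bump_def by measurable
  show ?thesis
    unfolding bump_hat_deriv_def fourier_def bump_hat_def lebesgue_d_def bump_monomial_def wave_def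
    by (subst integral_completion) auto
qed

lemma has_vector_derivative_bump_hat_deriv:
  assumes "set a \<subseteq> {..<d}" "i < d"
  shows "((\<lambda>s. bump_hat_deriv d a (t(i := s))) has_vector_derivative
    bump_hat_deriv d (i # a) (t(i := s))) (at s)"
  unfolding bump_hat_deriv_def bump_monomial_Cons
  by (intro has_vector_derivative_fourier integrable_bump_monomial bump_monomial_support(2) assms)
     (use assms in auto)

text \<open>Bessel's inequality moves the norm to the monomial side, where the pointwise bound
  leaves the squared norm of the bump, which is 1.\<close>

lemma nn_integral_bump_hat_deriv_sqr:
  assumes "set a \<subseteq> {..<d}"
  shows "(\<integral>\<^sup>+t. (ennreal (norm (bump_hat_deriv d a t)))\<^sup>2 \<partial>lborel_d d)
    \<le> ennreal (list_fact d a / fact (length a))"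
proof -
  have [measurable]: "bump d \<in> borel_measurable (lborel_d d)"
    unfolding bump_def by measurable
  have "(\<integral>\<^sup>+t. (ennreal (norm (bump_hat_deriv d a t)))\<^sup>2 \<partial>lborel_d d)
      \<le> (\<integral>\<^sup>+x. ennreal ((norm (bump_monomial d a x))\<^sup>2) \<partial>lborel_d d)"
    unfolding bump_hat_deriv_def
    using bessel[OF integrable_bump_monomial[OF assms]] by (simp add: ennreal_power)
  also have "\<dots> \<le> (\<integral>\<^sup>+x. ennreal (list_fact d a / fact (length a)) * ennreal ((bump d x)\<^sup>2) \<partial>lborel_d d)"
    using norm_bump_monomial_sqr_le[OF assms]
    by (intro nn_integral_mono) (simp flip: ennreal_mult)
  also have "\<dots> = ennreal (list_fact d a / fact (length a))"
    by (subst nn_integral_cmult) (auto simp: nn_integral_bump_sqr)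
  finally show ?thesis .
qed

text \<open>The derivative of the square of \<open>bump_hat\<close> along L, fully expanded. It
  stays complex here; the real part is taken in \<open>mollifier_deriv\<close>.\<close>

definition kernel_deriv :: "nat \<Rightarrow> nat list \<Rightarrow> (nat \<Rightarrow> real) \<Rightarrow> complex" where
  "kernel_deriv d L t = (\<Sum>(a, b)\<leftarrow>splits L. bump_hat_deriv d a t * bump_hat_deriv d b t)"

lemma kernel_deriv_Nil: "kernel d t = Re (kernel_deriv d [] t)"
  by (simp add: kernel_def kernel_deriv_def bump_hat_deriv_Nil power2_eq_square)

lemma splits_hat_sum_measurable:
  assumes "set L \<subseteq> {..<d}" "set ps \<subseteq> set (splits L)"
  shows "(\<lambda>t. \<Sum>(a, b)\<leftarrow>ps. bump_hat_deriv d a t * bump_hat_deriv d b t) \<in> borel_measurable (lborel_d d)"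
  using assms(2)
proof (induction ps)
  case (Cons p ps)
  obtain a b where p: "p = (a, b)" by force
  have "set a \<subseteq> {..<d}" "set b \<subseteq> {..<d}"
    using Cons.prems splits_subset[of a b L] assms(1) p by auto
  then have [measurable]: "bump_hat_deriv d a \<in> borel_measurable (lborel_d d)"
    "bump_hat_deriv d b \<in> borel_measurable (lborel_d d)"
    by simp_all
  have [measurable]: "(\<lambda>t. \<Sum>(a, b)\<leftarrow>ps. bump_hat_deriv d a t * bump_hat_deriv d b t)
      \<in> borel_measurable (lborel_d d)"
    using Cons by simp
  show ?case unfolding p by simp
qed simp

lemma kernel_deriv_measurable [measurable]:
  "set L \<subseteq> {..<d} \<Longrightarrow> kernel_deriv d L \<in> borel_measurable (lborel_d d)"
  unfolding kernel_deriv_def [abs_def] by (rule splits_hat_sum_measurable) auto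

lemma has_vector_derivative_kernel_deriv:
  assumes L: "set L \<subseteq> {..<d}" and i: "i < d"
  shows "((\<lambda>s. kernel_deriv d L (t(i := s))) has_vector_derivative
    kernel_deriv d (i # L) (t(i := s))) (at s)"
proof -
  \<comment> \<open>Generalised from \<open>splits L\<close> to any list of pairs, so that induction
    applies. The differentiated list has the shape of the recursion clause of \<open>splits\<close>,
    hence for \<open>splits L\<close> it is \<open>splits (i # L)\<close>.\<close>
  have *: "((\<lambda>s. \<Sum>(a, b)\<leftarrow>ps. bump_hat_deriv d a (t(i := s)) * bump_hat_deriv d b (t(i := s)))
      has_vector_derivative
      (\<Sum>(a, b)\<leftarrow>map (\<lambda>(a, b). (i # a, b)) ps @ map (\<lambda>(a, b). (a, i # b)) ps.
        bump_hat_deriv d a (t(i := s)) * bump_hat_deriv d b (t(i := s)))) (at s)"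
    if "\<And>a b. (a, b) \<in> set ps \<Longrightarrow> set a \<subseteq> {..<d} \<and> set b \<subseteq> {..<d}" for ps
    using that
  proof (induction ps)
    case (Cons p ps)
    obtain a b where p: "p = (a, b)" by force
    have "set a \<subseteq> {..<d}" "set b \<subseteq> {..<d}"
      using Cons.prems[of a b] p by auto
    from this[THEN has_vector_derivative_bump_hat_deriv[OF _ i, of _ t s]]
    have ab: "((\<lambda>s. bump_hat_deriv d a (t(i := s)) * bump_hat_deriv d b (t(i := s))) has_vector_derivative
        bump_hat_deriv d a (t(i := s)) * bump_hat_deriv d (i # b) (t(i := s)) +
        bump_hat_deriv d (i # a) (t(i := s)) * bump_hat_deriv d b (t(i := s))) (at s)"
      by (rule has_vector_derivative_mult)
    have "((\<lambda>s. \<Sum>(a, b)\<leftarrow>ps. bump_hat_deriv d a (t(i := s)) * bump_hat_deriv d b (t(i := s)))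
      has_vector_derivative
      (\<Sum>(a, b)\<leftarrow>map (\<lambda>(a, b). (i # a, b)) ps @ map (\<lambda>(a, b). (a, i # b)) ps.
        bump_hat_deriv d a (t(i := s)) * bump_hat_deriv d b (t(i := s)))) (at s)"
      by (rule Cons.IH) (use Cons.prems in auto)
    from has_vector_derivative_add[OF ab this] show ?case
      unfolding p by (simp add: algebra_simps fun_upd_def)
  qed simp
  have "set a \<subseteq> {..<d} \<and> set b \<subseteq> {..<d}" if "(a, b) \<in> set (splits L)" for a b
    using splits_subset[OF that] L by blast
  from *[of "splits L", OF this] show ?thesis
    unfolding kernel_deriv_def splits.simps by blast
qed

lemma ennreal_power2_le_imp_le:
  assumes "x\<^sup>2 \<le> (ennreal r)\<^sup>2" "0 \<le> r"
  shows "x \<le> ennreal r"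
proof (cases x)
  case (real s)
  with assms show ?thesis
    by (auto simp: ennreal_power intro!: ennreal_leI intro: power2_le_imp_le)
next
  case top
  with assms show ?thesis
    by (auto simp: ennreal_power top_unique)
qed

text \<open>Cauchy-Schwarz gives a product of two squared L^2 norms, and
  \<open>splits_fact_le\<close> bounds it by a value that is the same for all splits.\<close>

lemma nn_integral_bump_hat_deriv_mult:
  assumes L: "set L \<subseteq> {..<d}" and ab: "(a, b) \<in> set (splits L)"
  shows "(\<integral>\<^sup>+t. ennreal (norm (bump_hat_deriv d a t * bump_hat_deriv d b t)) \<partial>lborel_d d)
    \<le> ennreal (sqrt (2 ^ length L * list_fact d L / fact (length L)))"
proof -
  let ?A = "list_fact d a / fact (length a)" and ?B = "list_fact d b / fact (length b)"
  let ?C = "2 ^ length L * list_fact d L / fact (length L)"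
  have s: "set a \<subseteq> {..<d}" "set b \<subseteq> {..<d}"
    using splits_subset[OF ab] L by auto
  then have [measurable]: "bump_hat_deriv d a \<in> borel_measurable (lborel_d d)"
    "bump_hat_deriv d b \<in> borel_measurable (lborel_d d)"
    by simp_all
  let ?I = "\<integral>\<^sup>+t. ennreal (norm (bump_hat_deriv d a t)) * ennreal (norm (bump_hat_deriv d b t)) \<partial>lborel_d d"
  have "?I\<^sup>2 \<le> (\<integral>\<^sup>+t. (ennreal (norm (bump_hat_deriv d a t)))\<^sup>2 \<partial>lborel_d d) *
      (\<integral>\<^sup>+t. (ennreal (norm (bump_hat_deriv d b t)))\<^sup>2 \<partial>lborel_d d)"
    by (rule Cauchy_Schwarz_nn_integral) measurable
  also have "\<dots> \<le> ennreal ?A * ennreal ?B"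
    using s by (intro mult_mono nn_integral_bump_hat_deriv_sqr) auto
  also have "\<dots> = ennreal (?A * ?B)"
    by (simp flip: ennreal_mult)
  also have "\<dots> \<le> ennreal ?C"
    using splits_fact_le[OF ab, of d] by (intro ennreal_leI) simp
  also have "\<dots> = (ennreal (sqrt ?C))\<^sup>2"
    by (simp add: ennreal_power)
  finally have "?I \<le> ennreal (sqrt ?C)"
    by (rule ennreal_power2_le_imp_le) simp
  then show ?thesis
    by (simp add: norm_mult ennreal_mult)
qed

lemma nn_integral_kernel_deriv:
  assumes L: "set L \<subseteq> {..<d}"
  shows "(\<integral>\<^sup>+t. ennreal (norm (kernel_deriv d L t)) \<partial>lborel_d d)
    \<le> ennreal (2 ^ length L * sqrt (2 ^ length L * list_fact d L / fact (length L)))"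
proof -
  let ?C = "sqrt (2 ^ length L * list_fact d L / fact (length L))"
  \<comment> \<open>The triangle inequality over the Leibniz terms, for any list of them to permit
    induction; \<open>splits L\<close> itself has 2^n entries.\<close>
  have "(\<integral>\<^sup>+t. ennreal (norm (\<Sum>(a, b)\<leftarrow>ps. bump_hat_deriv d a t * bump_hat_deriv d b t)) \<partial>lborel_d d)
      \<le> of_nat (length ps) * ennreal ?C" if "set ps \<subseteq> set (splits L)" for ps
    using that
  proof (induction ps)
    case (Cons p ps)
    obtain a b where p: "p = (a, b)" by force
    have ab: "(a, b) \<in> set (splits L)" using Cons.prems p by auto
    then have "set a \<subseteq> {..<d}" "set b \<subseteq> {..<d}"
      using splits_subset[OF ab] L by auto
    then have [measurable]: "bump_hat_deriv d a \<in> borel_measurable (lborel_d d)"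
      "bump_hat_deriv d b \<in> borel_measurable (lborel_d d)"
      by simp_all
    let ?u = "\<lambda>t. bump_hat_deriv d a t * bump_hat_deriv d b t"
    let ?v = "\<lambda>t. \<Sum>(a, b)\<leftarrow>ps. bump_hat_deriv d a t * bump_hat_deriv d b t"
    have [measurable]: "?v \<in> borel_measurable (lborel_d d)"
      using Cons.prems by (intro splits_hat_sum_measurable[OF L]) auto
    have "(\<integral>\<^sup>+t. ennreal (norm (?u t + ?v t)) \<partial>lborel_d d)
        \<le> (\<integral>\<^sup>+t. ennreal (norm (?u t)) + ennreal (norm (?v t)) \<partial>lborel_d d)"
      by (intro nn_integral_mono) (simp add: norm_triangle_ineq flip: ennreal_plus)
    also have "\<dots> = (\<integral>\<^sup>+t. ennreal (norm (?u t)) \<partial>lborel_d d) + (\<integral>\<^sup>+t. ennreal (norm (?v t)) \<partial>lborel_d d)"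
      by (rule nn_integral_add) measurable
    also have "\<dots> \<le> ennreal ?C + of_nat (length ps) * ennreal ?C"
      using Cons by (intro add_mono nn_integral_bump_hat_deriv_mult[OF L ab] Cons.IH) auto
    finally show ?case
      unfolding p by (simp add: distrib_right)
  qed simp
  from this[of "splits L"] show ?thesis
    by (simp add: kernel_deriv_def length_splits ennreal_mult flip: ennreal_power)
qed

section \<open>Differentiation of a convolution\<close>

text \<open>By the mean value theorem the remainder is h (f1 r - f1 0), and the increment of
  \<open>f1\<close> is an integral of \<open>f2\<close> inside [-|h|,|h|]. An integral of |f2|,
  unlike its supremum, can afterwards be integrated over all of space.\<close>

lemma taylor_remainder_le_nn_integral:
  fixes f :: "real \<Rightarrow> real"
  assumes f: "\<And>s. (f has_real_derivative f1 s) (at s)"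
    and f1: "\<And>s. (f1 has_real_derivative f2 s) (at s)" and f2: "continuous_on UNIV f2"
  shows "ennreal \<bar>f h - f 0 - h * f1 0\<bar>
    \<le> ennreal \<bar>h\<bar> * (\<integral>\<^sup>+r. indicator {-\<bar>h\<bar>..\<bar>h\<bar>} r * ennreal \<bar>f2 r\<bar> \<partial>lborel)"
proof -
  let ?J = "\<integral>\<^sup>+r. indicator {-\<bar>h\<bar>..\<bar>h\<bar>} r * ennreal \<bar>f2 r\<bar> \<partial>lborel"
  have le: "ennreal \<bar>f1 b - f1 a\<bar> \<le> ?J" if "a \<le> b" "{a..b} \<subseteq> {-\<bar>h\<bar>..\<bar>h\<bar>}" for a b
  proof -
    have "(\<integral>x. indicator {a..b} x *\<^sub>R f2 x \<partial>lborel) = f1 b - f1 a"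
    proof (rule integral_FTC_atLeastAtMost[OF that(1)])
      show "(f1 has_vector_derivative f2 x) (at x within {a..b})" for x
        using f1[of x] has_real_derivative_iff_has_vector_derivative has_vector_derivative_at_within
        by blast
      show "continuous_on {a..b} f2"
        using f2 continuous_on_subset by blast
    qed
    then have "ennreal \<bar>f1 b - f1 a\<bar> \<le> (\<integral>\<^sup>+x. ennreal (norm (indicator {a..b} x *\<^sub>R f2 x)) \<partial>lborel)"
      using norm_integral_le_nn_integral[of lborel "\<lambda>x. indicator {a..b} x *\<^sub>R f2 x"] by simp
    also have "\<dots> \<le> ?J"
      by (intro nn_integral_mono) (use that(2) in \<open>auto simp: indicator_def\<close>)
    finally show ?thesis .
  qed
  \<comment> \<open>An intermediate point for either sign of h; for h = 0 it is 0.\<close>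
  have "\<exists>r. \<bar>r\<bar> \<le> \<bar>h\<bar> \<and> f h - f 0 = h * f1 r"
  proof (cases h "0::real" rule: linorder_cases)
    case less
    then obtain z where "h < z" "z < 0" "f 0 - f h = (0 - h) * f1 z"
      using MVT2[of h 0 f f1] f by auto
    then show ?thesis by (intro exI[of _ z]) (auto simp: algebra_simps)
  next
    case greater
    then obtain z where "0 < z" "z < h" "f h - f 0 = (h - 0) * f1 z"
      using MVT2[of 0 h f f1] f by auto
    then show ?thesis by (intro exI[of _ z]) auto
  qed auto
  then obtain r where r: "\<bar>r\<bar> \<le> \<bar>h\<bar>" "f h - f 0 = h * f1 r" by blast
  then have "\<bar>f h - f 0 - h * f1 0\<bar> = \<bar>h\<bar> * \<bar>f1 r - f1 0\<bar>"
    by (simp flip: abs_mult right_diff_distrib)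
  moreover have "ennreal \<bar>f1 r - f1 0\<bar> \<le> ?J"
  proof (cases "0 \<le> r")
    case True
    then show ?thesis using r by (intro le) auto
  next
    case False
    then have "ennreal \<bar>f1 0 - f1 r\<bar> \<le> ?J" using r by (intro le) auto
    then show ?thesis by (simp add: abs_minus_commute)
  qed
  ultimately show ?thesis
    by (simp add: ennreal_mult mult_left_mono)
qed

text \<open>Turns the shift of one coordinate into a translation of space, under which the measure
  is invariant.\<close>

lemma upd_eq_vaffine:
  assumes "i < d" "z \<in> rspace d"
  shows "z(i := z i + r) = vaffine d (\<lambda>j. if j = i then r else 0) 1 z"
  using assms by (auto simp: vaffine_def rspace_def fun_eq_iff PiE_def extensional_def restrict_def)

lemma vdiff_eq_vaffine: "vdiff d x y = vaffine d x (-1) y"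
  by (simp add: vdiff_def vaffine_def)

lemma vdiff_measurable [measurable]: "vdiff d x \<in> measurable (lborel_d d) (lborel_d d)"
  unfolding vdiff_def by measurable

lemma nn_integral_vdiff:
  assumes "f \<in> borel_measurable (lborel_d d)"
  shows "(\<integral>\<^sup>+y. f (vdiff d x y) \<partial>lborel_d d) = (\<integral>\<^sup>+y. f y \<partial>lborel_d d)"
  using nn_integral_vaffine[of "-1" f d x] assms by (simp add: vdiff_eq_vaffine)

text \<open>The point x enters through \<open>f\<close> alone, so that all derivatives fall on
  \<open>f\<close>.\<close>

definition conv :: "nat \<Rightarrow> ((nat \<Rightarrow> real) \<Rightarrow> real) \<Rightarrow> ((nat \<Rightarrow> real) \<Rightarrow> real) \<Rightarrow> (nat \<Rightarrow> real) \<Rightarrow> real" where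
  "conv d f F x = (LINT y|lborel_d d. f (vdiff d x y) * F y)"

text \<open>Young's inequality for an L^1 and a bounded function; the map y -> x - y preserves the
  measure.\<close>

lemma
  assumes f: "f \<in> borel_measurable (lborel_d d)" and F: "F \<in> borel_measurable (lborel_d d)"
    and M: "\<And>y. \<bar>F y\<bar> \<le> M"
  shows conv_le: "ennreal \<bar>conv d f F x\<bar> \<le> ennreal M * (\<integral>\<^sup>+z. ennreal \<bar>f z\<bar> \<partial>lborel_d d)"
    and integrable_conv: "(\<integral>\<^sup>+z. ennreal \<bar>f z\<bar> \<partial>lborel_d d) < \<infinity> \<Longrightarrow>
      integrable (lborel_d d) (\<lambda>y. f (vdiff d x y) * F y)"
proof -
  let ?P = "lborel_d d"
  note [measurable] = f F
  have M0: "0 \<le> M" using M[of undefined] by linarith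
  have "(\<integral>\<^sup>+y. ennreal (norm (f (vdiff d x y) * F y)) \<partial>?P)
      \<le> (\<integral>\<^sup>+y. ennreal M * ennreal \<bar>f (vdiff d x y)\<bar> \<partial>?P)"
    using M M0 by (intro nn_integral_mono) (auto simp: abs_mult mult.commute[of M] intro!: ennreal_leI mult_left_mono simp flip: ennreal_mult)
  also have "\<dots> = ennreal M * (\<integral>\<^sup>+y. ennreal \<bar>f (vdiff d x y)\<bar> \<partial>?P)"
    by (rule nn_integral_cmult) measurable
  also have "(\<integral>\<^sup>+y. ennreal \<bar>f (vdiff d x y)\<bar> \<partial>?P) = (\<integral>\<^sup>+z. ennreal \<bar>f z\<bar> \<partial>?P)"
    by (rule nn_integral_vdiff) measurable
  finally have *: "(\<integral>\<^sup>+y. ennreal (norm (f (vdiff d x y) * F y)) \<partial>?P) \<le> ennreal M * (\<integral>\<^sup>+z. ennreal \<bar>f z\<bar> \<partial>?P)" .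
  show "ennreal \<bar>conv d f F x\<bar> \<le> ennreal M * (\<integral>\<^sup>+z. ennreal \<bar>f z\<bar> \<partial>?P)"
    using order_trans[OF norm_integral_le_nn_integral *] by (simp add: conv_def)
  assume "(\<integral>\<^sup>+z. ennreal \<bar>f z\<bar> \<partial>?P) < \<infinity>"
  then have "ennreal M * (\<integral>\<^sup>+z. ennreal \<bar>f z\<bar> \<partial>?P) < \<infinity>"
    by (simp add: ennreal_mult_less_top)
  with * show "integrable ?P (\<lambda>y. f (vdiff d x y) * F y)"
    by (intro integrableI_bounded) (auto intro: le_less_trans)
qed

text \<open>
  Second-order Taylor expansion, integrated over all of space: the remainder is controlled by the
  norm of \<open>f2\<close> in \<open>L\<^sup>1\<close> alone, so no pointwise domination is needed to
  differentiate under the integral sign.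
\<close>

lemma nn_integral_taylor_remainder:
  assumes i: "i < d"
    and f [measurable]: "f \<in> borel_measurable (lborel_d d)" "f1 \<in> borel_measurable (lborel_d d)"
      "f2 \<in> borel_measurable (lborel_d d)"
    and d1: "\<And>z s. ((\<lambda>s. f (z(i := s))) has_real_derivative f1 (z(i := s))) (at s)"
    and d2: "\<And>z s. ((\<lambda>s. f1 (z(i := s))) has_real_derivative f2 (z(i := s))) (at s)"
    and c2: "\<And>z. continuous_on UNIV (\<lambda>s. f2 (z(i := s)))"
  shows "(\<integral>\<^sup>+z. ennreal \<bar>f (z(i := z i + h)) - f z - h * f1 z\<bar> \<partial>lborel_d d)
    \<le> ennreal (2 * h\<^sup>2) * (\<integral>\<^sup>+z. ennreal \<bar>f2 z\<bar> \<partial>lborel_d d)"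
proof -
  let ?P = "lborel_d d"
  let ?e = "\<lambda>r j. if j = i then r else 0 :: real"
  let ?I = "indicator {-\<bar>h\<bar>..\<bar>h\<bar>} :: real \<Rightarrow> ennreal"
  interpret pair_sigma_finite ?P "lborel :: real measure"
    by (intro pair_sigma_finite.intro sigma_finite_lborel_d) standard
  have pt: "ennreal \<bar>f (z(i := z i + h)) - f z - h * f1 z\<bar>
      \<le> ennreal \<bar>h\<bar> * (\<integral>\<^sup>+r. ?I r * ennreal \<bar>f2 (vaffine d (?e r) 1 z)\<bar> \<partial>lborel)" if z: "z \<in> space ?P" for z
  proof -
    have s: "((\<lambda>r. f (z(i := z i + r))) has_real_derivative f1 (z(i := z i + r))) (at r)"
      "((\<lambda>r. f1 (z(i := z i + r))) has_real_derivative f2 (z(i := z i + r))) (at r)" for r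
      using d1[of z "z i + r"] d2[of z "z i + r"] DERIV_shift[of _ _ r "z i"] by (auto simp: add.commute)
    have "continuous_on UNIV (\<lambda>r. f2 (z(i := z i + r)))"
      by (rule continuous_on_compose2[OF c2[of z], of UNIV "\<lambda>r. z i + r"]) (auto intro!: continuous_intros)
    from taylor_remainder_le_nn_integral[OF s this, of h] show ?thesis
      using z i by (simp add: upd_eq_vaffine space_lborel_d cong: if_cong)
  qed
  have [measurable]: "(\<lambda>(z, r). vaffine d (?e r) 1 z) \<in> measurable (?P \<Otimes>\<^sub>M lborel) ?P"
    unfolding vaffine_def by measurable
  have m: "(\<lambda>(z, r). ?I r * ennreal \<bar>f2 (vaffine d (?e r) 1 z)\<bar>) \<in> borel_measurable (?P \<Otimes>\<^sub>M lborel)"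
    by measurable
  have "(\<integral>\<^sup>+z. ennreal \<bar>f (z(i := z i + h)) - f z - h * f1 z\<bar> \<partial>?P)
      \<le> (\<integral>\<^sup>+z. ennreal \<bar>h\<bar> * (\<integral>\<^sup>+r. ?I r * ennreal \<bar>f2 (vaffine d (?e r) 1 z)\<bar> \<partial>lborel) \<partial>?P)"
    by (intro nn_integral_mono pt)
  also have "\<dots> = ennreal \<bar>h\<bar> * (\<integral>\<^sup>+z. (\<integral>\<^sup>+r. ?I r * ennreal \<bar>f2 (vaffine d (?e r) 1 z)\<bar> \<partial>lborel) \<partial>?P)"
    using m by (intro nn_integral_cmult lborel.borel_measurable_nn_integral)
  also have "(\<integral>\<^sup>+z. (\<integral>\<^sup>+r. ?I r * ennreal \<bar>f2 (vaffine d (?e r) 1 z)\<bar> \<partial>lborel) \<partial>?P)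
      = (\<integral>\<^sup>+r. (\<integral>\<^sup>+z. ?I r * ennreal \<bar>f2 (vaffine d (?e r) 1 z)\<bar> \<partial>?P) \<partial>lborel)"
    by (rule Fubini'[symmetric]) (rule m)
  \<comment> \<open>For fixed r the inner integral is over a translate, so r disappears and only the
    length 2 |h| of the interval remains.\<close>
  also have "\<dots> = (\<integral>\<^sup>+r. ?I r * (\<integral>\<^sup>+z. ennreal \<bar>f2 z\<bar> \<partial>?P) \<partial>lborel)"
  proof (intro nn_integral_cong)
    fix r
    have "(\<integral>\<^sup>+z. ?I r * ennreal \<bar>f2 (vaffine d (?e r) 1 z)\<bar> \<partial>?P)
        = ?I r * (\<integral>\<^sup>+z. ennreal \<bar>f2 (vaffine d (?e r) 1 z)\<bar> \<partial>?P)"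
      by (rule nn_integral_cmult) measurable
    also have "(\<integral>\<^sup>+z. ennreal \<bar>f2 (vaffine d (?e r) 1 z)\<bar> \<partial>?P) = (\<integral>\<^sup>+z. ennreal \<bar>f2 z\<bar> \<partial>?P)"
      using nn_integral_vaffine[of 1 "\<lambda>z. ennreal \<bar>f2 z\<bar>" d "?e r"] by simp
    finally show "(\<integral>\<^sup>+z. ?I r * ennreal \<bar>f2 (vaffine d (?e r) 1 z)\<bar> \<partial>?P)
        = ?I r * (\<integral>\<^sup>+z. ennreal \<bar>f2 z\<bar> \<partial>?P)" .
  qed
  also have "\<dots> = ennreal (2 * \<bar>h\<bar>) * (\<integral>\<^sup>+z. ennreal \<bar>f2 z\<bar> \<partial>?P)"
    by (simp add: nn_integral_multc)
  also have "ennreal \<bar>h\<bar> * \<dots> = ennreal (2 * h\<^sup>2) * (\<integral>\<^sup>+z. ennreal \<bar>f2 z\<bar> \<partial>?P)"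
  proof -
    have "2 * h\<^sup>2 = \<bar>h\<bar> * (2 * \<bar>h\<bar>)"
      by (cases "0 \<le> h") (auto simp: power2_eq_square)
    then show ?thesis
      by (simp only: ennreal_mult abs_ge_zero mult_nonneg_nonneg zero_le_numeral mult.assoc)
  qed
  finally show ?thesis .
qed

text \<open>By linearity, the remainder of the convolution is the convolution of the Taylor
  remainder \<open>R\<close> with \<open>F\<close>. Young's inequality and the L^1 estimate of
  \<open>R\<close> make it at most 2 M N h^2, with N the L^1 norm of \<open>f2\<close>.\<close>

lemma has_real_derivative_conv:
  assumes i: "i < d"
    and f [measurable]: "f \<in> borel_measurable (lborel_d d)" "f1 \<in> borel_measurable (lborel_d d)"
      "f2 \<in> borel_measurable (lborel_d d)"
    and int: "(\<integral>\<^sup>+z. ennreal \<bar>f z\<bar> \<partial>lborel_d d) < \<infinity>" "(\<integral>\<^sup>+z. ennreal \<bar>f1 z\<bar> \<partial>lborel_d d) < \<infinity>"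
      "(\<integral>\<^sup>+z. ennreal \<bar>f2 z\<bar> \<partial>lborel_d d) < \<infinity>"
    and d1: "\<And>z s. ((\<lambda>s. f (z(i := s))) has_real_derivative f1 (z(i := s))) (at s)"
    and d2: "\<And>z s. ((\<lambda>s. f1 (z(i := s))) has_real_derivative f2 (z(i := s))) (at s)"
    and c2: "\<And>z. continuous_on UNIV (\<lambda>s. f2 (z(i := s)))"
    and F [measurable]: "F \<in> borel_measurable (lborel_d d)" and M: "\<And>y. \<bar>F y\<bar> \<le> M"
  shows "((\<lambda>s. conv d f F (x(i := s))) has_real_derivative conv d f1 F (x(i := s))) (at s)"
  unfolding has_real_derivative_iff_has_vector_derivative
proof (rule has_vector_derivative_quadratic)
  fix h :: real
  let ?P = "lborel_d d"
  define R where "R z = f (z(i := z i + h)) - f z - h * f1 z" for z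
  define N where "N = enn2real (\<integral>\<^sup>+z. ennreal \<bar>f2 z\<bar> \<partial>?P)"
  have M0: "0 \<le> M" using M[of undefined] by linarith
  have [measurable]: "(\<lambda>z. z(i := z i + h)) \<in> measurable ?P ?P"
    using measurable_vaffine[of d "\<lambda>j. if j = i then h else 0" 1] upd_eq_vaffine[OF i]
    by (subst measurable_cong) (auto simp: space_lborel_d)
  have [measurable]: "R \<in> borel_measurable ?P"
    unfolding R_def by measurable
  have up: "vdiff d (x(i := s + h)) y = (vdiff d (x(i := s)) y)(i := vdiff d (x(i := s)) y i + h)" for y
    using i by (auto simp: vdiff_def fun_eq_iff)
  have I: "integrable ?P (\<lambda>y. f (vdiff d u y) * F y)" "integrable ?P (\<lambda>y. f1 (vdiff d u y) * F y)" for u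
    using int by (auto intro!: integrable_conv[OF _ F M])
  have "conv d f F (x(i := s + h)) - conv d f F (x(i := s)) - h *\<^sub>R conv d f1 F (x(i := s))
      = (LINT y|?P. f (vdiff d (x(i := s + h)) y) * F y - f (vdiff d (x(i := s)) y) * F y
          - h *\<^sub>R (f1 (vdiff d (x(i := s)) y) * F y))"
    unfolding conv_def using I
    by (simp only: Bochner_Integration.integral_diff Bochner_Integration.integrable_diff
        integral_scaleR_right integrable_scaleR_right)
  also have "\<dots> = conv d R F (x(i := s))"
    unfolding conv_def R_def up by (simp add: algebra_simps)
  finally have eq: "conv d f F (x(i := s + h)) - conv d f F (x(i := s)) - h *\<^sub>R conv d f1 F (x(i := s))
      = conv d R F (x(i := s))" .
  have "ennreal \<bar>conv d R F (x(i := s))\<bar> \<le> ennreal M * (\<integral>\<^sup>+z. ennreal \<bar>R z\<bar> \<partial>?P)"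
    by (rule conv_le[OF _ F M]) measurable
  also have "\<dots> \<le> ennreal M * (ennreal (2 * h\<^sup>2) * (\<integral>\<^sup>+z. ennreal \<bar>f2 z\<bar> \<partial>?P))"
    unfolding R_def by (intro mult_left_mono nn_integral_taylor_remainder[OF i f d1 d2 c2]) auto
  also have "(\<integral>\<^sup>+z. ennreal \<bar>f2 z\<bar> \<partial>?P) = ennreal N"
    using int(3) by (simp add: N_def less_top)
  also have "ennreal M * (ennreal (2 * h\<^sup>2) * ennreal N) = ennreal (2 * M * N * h\<^sup>2)"
    using M0 by (simp add: N_def mult_ac flip: ennreal_mult)
  finally have "\<bar>conv d R F (x(i := s))\<bar> \<le> 2 * M * N * h\<^sup>2"
    by (subst (asm) ennreal_le_iff) (use M0 in \<open>auto simp: N_def\<close>)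
  then show "norm (conv d f F (x(i := s + h)) - conv d f F (x(i := s)) - h *\<^sub>R conv d f1 F (x(i := s)))
      \<le> 2 * M * N * h\<^sup>2"
    unfolding eq real_norm_def .
qed

section \<open>The mollified function\<close>

text \<open>The derivative along L of the scaled kernel: the chain rule adds one factor c per list
  entry to the initial c^d.\<close>

definition mollifier_deriv :: "nat \<Rightarrow> real \<Rightarrow> nat list \<Rightarrow> (nat \<Rightarrow> real) \<Rightarrow> real" where
  "mollifier_deriv d c L z = c ^ (d + length L) * Re (kernel_deriv d L (vscale d c z))"

lemma kernel_scaled_eq: "kernel_scaled d c = mollifier_deriv d c []"
  by (simp add: fun_eq_iff kernel_scaled_def mollifier_deriv_def kernel_deriv_Nil)

lemma vscale_eq_vaffine: "vscale d c z = vaffine d (\<lambda>_. 0) c z"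
  by (simp add: vscale_def vaffine_def)

lemma vscale_measurable [measurable]: "vscale d c \<in> measurable (lborel_d d) (lborel_d d)"
  unfolding vscale_def by measurable

lemma mollifier_deriv_measurable [measurable]:
  assumes "set L \<subseteq> {..<d}"
  shows "mollifier_deriv d c L \<in> borel_measurable (lborel_d d)"
proof -
  have [measurable]: "kernel_deriv d L \<in> borel_measurable (lborel_d d)"
    using assms by simp
  show ?thesis unfolding mollifier_deriv_def by measurable
qed

lemma has_real_derivative_mollifier_deriv:
  assumes "set L \<subseteq> {..<d}" "i < d"
  shows "((\<lambda>s. mollifier_deriv d c L (z(i := s))) has_real_derivative
    mollifier_deriv d c (i # L) (z(i := s))) (at s)"
proof -
  have u: "vscale d c (z(i := s)) = (vscale d c z)(i := c * s)" for s
    using assms(2) by (auto simp: vscale_def fun_eq_iff)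
  let ?k = "\<lambda>L s. Re (kernel_deriv d L ((vscale d c z)(i := s)))"
  have "(?k L has_real_derivative ?k (i # L) (c * s)) (at (c * s))"
    unfolding has_real_derivative_iff_has_vector_derivative
    by (rule bounded_linear.has_vector_derivative[OF bounded_linear_Re
          has_vector_derivative_kernel_deriv[OF assms]])
  moreover have "((\<lambda>s. c * s) has_real_derivative c) (at s)"
    by (auto intro!: derivative_eq_intros)
  ultimately have "((\<lambda>s. ?k L (c * s)) has_real_derivative ?k (i # L) (c * s) * c) (at s)"
    by (rule DERIV_chain2)
  from DERIV_cmult[OF this, of "c ^ (d + length L)"] show ?thesis
    unfolding mollifier_deriv_def u by (simp add: mult_ac)
qed

text \<open>The substitution t = c z uses up c^d, leaving one factor c per derivative.\<close>

lemma nn_integral_mollifier_deriv: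
  assumes L: "set L \<subseteq> {..<d}" and c: "0 < c"
  shows "(\<integral>\<^sup>+z. ennreal \<bar>mollifier_deriv d c L z\<bar> \<partial>lborel_d d)
    \<le> ennreal (c ^ length L * (2 ^ length L * sqrt (2 ^ length L * list_fact d L / fact (length L))))"
proof -
  let ?P = "lborel_d d"
  have [measurable]: "kernel_deriv d L \<in> borel_measurable ?P"
    using L by simp
  have "(\<integral>\<^sup>+z. ennreal \<bar>mollifier_deriv d c L z\<bar> \<partial>?P)
      = (\<integral>\<^sup>+z. ennreal (c ^ length L) * (ennreal (c ^ d) * ennreal \<bar>Re (kernel_deriv d L (vscale d c z))\<bar>) \<partial>?P)"
    using c by (intro nn_integral_cong)
      (simp add: mollifier_deriv_def abs_mult power_add mult_ac flip: ennreal_mult)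
  also have "\<dots> = ennreal (c ^ length L) * (ennreal (c ^ d) * (\<integral>\<^sup>+z. ennreal \<bar>Re (kernel_deriv d L (vscale d c z))\<bar> \<partial>?P))"
    by (simp add: nn_integral_cmult)
  also have "ennreal (c ^ d) * (\<integral>\<^sup>+z. ennreal \<bar>Re (kernel_deriv d L (vscale d c z))\<bar> \<partial>?P)
      = (\<integral>\<^sup>+t. ennreal \<bar>Re (kernel_deriv d L t)\<bar> \<partial>?P)"
    using nn_integral_vaffine[of c "\<lambda>t. ennreal \<bar>Re (kernel_deriv d L t)\<bar>" d "\<lambda>_. 0"] c
    by (simp add: vscale_eq_vaffine)
  also have "\<dots> \<le> (\<integral>\<^sup>+t. ennreal (norm (kernel_deriv d L t)) \<partial>?P)"
    by (intro nn_integral_mono ennreal_leI abs_Re_le_cmod)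
  also have "\<dots> \<le> ennreal (2 ^ length L * sqrt (2 ^ length L * list_fact d L / fact (length L)))"
    by (rule nn_integral_kernel_deriv[OF L])
  finally show ?thesis
    using c by (simp add: ennreal_mult mult_left_mono)
qed

text \<open>Induction on the list, with \<open>L\<close>, \<open>i # L\<close> and
  \<open>i # i # L\<close> indexing the function and its two derivatives. Agreement of
  \<open>G\<close> with the convolution on \<open>rspace d\<close> is enough, since updating a
  coordinate below d stays in \<open>rspace d\<close>.\<close>

lemma partials_of_conv:
  assumes c: "0 < c" and F: "F \<in> borel_measurable (lborel_d d)" and M: "\<And>y. \<bar>F y\<bar> \<le> M"
    and G: "\<And>x. x \<in> rspace d \<Longrightarrow> G x = conv d (mollifier_deriv d c []) F x"
    and L: "set L \<subseteq> {..<d}"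
  shows "partials_exist d L G \<and> (\<forall>x\<in>rspace d. partials L G x = conv d (mollifier_deriv d c L) F x)"
  using L
proof (induction L)
  case Nil
  then show ?case using G by simp
next
  case (Cons i L)
  have i: "i < d" and L: "set L \<subseteq> {..<d}" using Cons.prems by auto
  have fin: "(\<integral>\<^sup>+z. ennreal \<bar>mollifier_deriv d c K z\<bar> \<partial>lborel_d d) < top" if "set K \<subseteq> {..<d}" for K
    using nn_integral_mollifier_deriv[OF that c] by (rule le_less_trans) simp
  have cont: "continuous_on UNIV (\<lambda>s. mollifier_deriv d c (i # i # L) (z(i := s)))" for z
    by (rule DERIV_continuous_on, rule DERIV_subset, rule has_real_derivative_mollifier_deriv)
       (use i L in auto)
  have D: "((\<lambda>s. partials L G (x(i := s))) has_real_derivative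
      conv d (mollifier_deriv d c (i # L)) F x) (at (x i))" if x: "x \<in> rspace d" for x
  proof -
    have "x(i := s) \<in> rspace d" for s
      using x i by (auto simp: rspace_def PiE_def extensional_def)
    then have eq: "(\<lambda>s. partials L G (x(i := s))) = (\<lambda>s. conv d (mollifier_deriv d c L) F (x(i := s)))"
      using Cons.IH L by auto
    have "((\<lambda>s. conv d (mollifier_deriv d c L) F (x(i := s))) has_real_derivative
        conv d (mollifier_deriv d c (i # L)) F (x(i := x i))) (at (x i))"
      by (rule has_real_derivative_conv[where ?f2.0 = "mollifier_deriv d c (i # i # L)" and M = M])
         (use i L F M in \<open>auto intro!: fin cont has_real_derivative_mollifier_deriv
            mollifier_deriv_measurable simp del: fun_upd_apply\<close>)
    then show ?thesis unfolding eq by simp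
  qed
  show ?case
  proof (intro conjI ballI)
    show "partials_exist d (i # L) G"
      using Cons.IH L D by (auto intro!: differentiableI dest: has_field_derivative_imp_has_derivative)
    show "partials (i # L) G x = conv d (mollifier_deriv d c (i # L)) F x" if "x \<in> rspace d" for x
      using DERIV_imp_deriv[OF D[OF that]] by (simp add: partial_def)
  qed
qed

section \<open>From Lebesgue measurable to Borel measurable functions\<close>

text \<open>Off a null set the preimages under \<open>f\<close> and \<open>g\<close> coincide;
  inside it every set is measurable for the completion.\<close>

lemma borel_measurable_completion_AE_eq:
  assumes g: "g \<in> borel_measurable M" and ae: "AE x in M. f x = g x"
  shows "f \<in> borel_measurable (completion M)"
proof -
  obtain N where N: "{x \<in> space M. f x \<noteq> g x} \<subseteq> N" "N \<in> null_sets M"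
    using ae unfolding eventually_ae_filter by auto
  have gc: "g \<in> borel_measurable (completion M)"
    using g by (rule measurable_completion)
  have "f -` A \<inter> space (completion M) \<in> sets (completion M)" if A: "A \<in> sets borel" for A
  proof -
    let ?g = "g -` A \<inter> space M" and ?f = "f -` A \<inter> space M"
    have NN: "N \<in> null_sets (completion M)"
      using N(2) by (rule null_sets_completionI)
    have "?f \<inter> N \<in> sets (completion M)"
      using null_sets_completion_subset[OF _ NN, of "?f \<inter> N"] by auto
    moreover have "?g - N \<in> sets (completion M)"
      using measurable_sets[OF gc A] NN by auto
    moreover have "?f = (?f \<inter> N) \<union> (?g - N)"
      using N(1) by auto
    ultimately show ?thesis by (metis sets.Un space_completion)
  qed
  then show ?thesis by (intro measurableI) auto
qed

text \<open>\<open>F\<close> is replaced by a Borel function equal to it almost everywhere, which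
  does not change the integral. The reflection y -> x - y is an involution preserving the measure
  and moves x from \<open>F\<close> to the kernel.\<close>

lemma ft_mollify_eq_conv:
  assumes F: "F \<in> borel_measurable (lebesgue_d d)" and M: "\<And>y. y \<in> rspace d \<Longrightarrow> \<bar>F y\<bar> \<le> M"
    and "0 \<le> M"
  obtains F' where "F' \<in> borel_measurable (lborel_d d)" "\<And>y. \<bar>F' y\<bar> \<le> M"
    "\<And>x. x \<in> rspace d \<Longrightarrow> ft_mollify d c F x = conv d (mollifier_deriv d c []) F' x"
proof -
  let ?P = "lborel_d d" and ?k = "mollifier_deriv d c []"
  obtain g where g [measurable]: "g \<in> borel_measurable ?P" and ae: "AE y in ?P. F y = g y"
    using completion_ex_borel_measurable_real[OF F[unfolded lebesgue_d_def]] by blast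
  \<comment> \<open>Clipping makes the bound hold at every point, while almost everywhere nothing
    changes because |F| <= M on \<open>rspace d\<close>.\<close>
  define F' where "F' y = max (- M) (min M (g y))" for y
  have F' [measurable]: "F' \<in> borel_measurable ?P"
    unfolding F'_def by measurable
  have k [measurable]: "?k \<in> borel_measurable ?P"
    by simp
  have "AE y in ?P. y \<in> rspace d"
    by (rule AE_I2) (simp add: space_lborel_d)
  with ae have ae': "AE y in ?P. F y = F' y"
    by eventually_elim (use M in \<open>force simp: F'_def\<close>)
  have "ft_mollify d c F x = conv d ?k F' x" if x: "x \<in> rspace d" for x
  proof -
    have ae2: "AE y in ?P. ?k y * F (vdiff d x y) = ?k y * F' (vdiff d x y)"
      using AE_vaffine[OF _ ae', of "-1" x] by (simp add: vdiff_eq_vaffine, elim eventually_mono) auto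
    have vv: "vdiff d x (vdiff d x y) = y" if "y \<in> space ?P" for y
      using that by (auto simp: vdiff_def space_lborel_d rspace_def fun_eq_iff PiE_def extensional_def)
    have "ft_mollify d c F x = (LINT y|completion ?P. ?k y * F (vdiff d x y))"
      by (simp add: ft_mollify_def kernel_scaled_eq lebesgue_d_def)
    also have "\<dots> = (LINT y|completion ?P. ?k y * F' (vdiff d x y))"
      using ae2
      by (intro integral_cong_AE borel_measurable_completion_AE_eq[OF _ ae2] measurable_completion
          AE_completion) measurable
    also have "\<dots> = (LINT y|?P. ?k y * F' (vdiff d x y))"
      by (rule integral_completion) measurable
    also have "\<dots> = (LINT y|?P. ?k (vdiff d x y) * F' (vdiff d x (vdiff d x y)))"
      using integral_vaffine[of "-1" "\<lambda>y. ?k y * F' (vdiff d x y)" d x]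
      by (simp add: vdiff_eq_vaffine)
    also have "\<dots> = conv d ?k F' x"
      unfolding conv_def by (intro Bochner_Integration.integral_cong) (auto simp: vv)
    finally show ?thesis .
  qed
  moreover have "\<bar>F' y\<bar> \<le> M" for y
    using \<open>0 \<le> M\<close> by (auto simp: F'_def)
  ultimately show ?thesis
    using that[of F'] F' by blast
qed

text \<open>The single term n^n / n! of the exponential series at n is at most e^n, and e <=
  4.\<close>

lemma power_self_le_fact: "real n ^ n \<le> 4 ^ n * fact n"
proof -
  have "(\<lambda>k. real n ^ k /\<^sub>R fact k) sums exp (real n)"
    by (rule exp_converges)
  then have "(\<Sum>k\<in>{n}. real n ^ k /\<^sub>R fact k) \<le> exp (real n)"
    using sum_le_suminf[of "\<lambda>k. real n ^ k /\<^sub>R fact k" "{n}"] by (auto simp: sums_iff)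
  also have "\<dots> = exp 1 ^ n"
    by (simp flip: exp_of_nat_mult)
  also have "\<dots> \<le> 4 ^ n"
    using exp_le by (intro power_mono) auto
  finally show ?thesis
    by (simp add: field_simps)
qed

text \<open>With 1/n! <= 4^n / n^n the radicand acquires the factor 8^n, which is enlarged to 16^n
  to have the exact root 4^n. The 2^n Leibniz terms raise this to 8^n = 2^(3n).\<close>

lemma multinomial_factor_le:
  assumes "0 < n"
  shows "2 ^ n * sqrt (2 ^ n * real B / fact n)
    \<le> 2 powr (3 * real n) * sqrt (real B * real n powr (- real n))"
proof -
  have n: "real n powr (- real n) = 1 / real n ^ n"
    using assms by (simp add: powr_minus powr_realpow divide_inverse)
  have "1 / fact n \<le> 4 ^ n / real n ^ n"
    using power_self_le_fact[of n] assms by (simp add: field_simps)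
  then have "2 ^ n * real B * (1 / fact n) \<le> 2 ^ n * real B * (4 ^ n / real n ^ n)"
    by (intro mult_left_mono) auto
  also have "\<dots> = 8 ^ n * (real B / real n ^ n)"
    by (simp flip: power_mult_distrib)
  also have "\<dots> \<le> 16 ^ n * (real B / real n ^ n)"
    by (intro mult_right_mono power_mono) auto
  finally have le: "sqrt (2 ^ n * real B / fact n) \<le> sqrt (16 ^ n * (real B / real n ^ n))"
    by simp
  have "sqrt (16 ^ n) = (4::real) ^ n"
    by (intro real_sqrt_unique) (auto simp: power2_eq_square simp flip: power_mult_distrib)
  then have s: "sqrt (16 ^ n * (real B / real n ^ n)) = 4 ^ n * sqrt (real B / real n ^ n)"
    by (simp only: real_sqrt_mult)
  from le have "2 ^ n * sqrt (2 ^ n * real B / fact n) \<le> 2 ^ n * (4 ^ n * sqrt (real B / real n ^ n))"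
    unfolding s by (intro mult_left_mono) auto
  also have "2 ^ n * (4 ^ n * sqrt (real B / real n ^ n)) = 8 ^ n * sqrt (real B / real n ^ n)"
    by (simp add: mult.assoc [symmetric] flip: power_mult_distrib)
  also have "(8::real) ^ n = 2 powr (3 * real n)"
    by (simp add: powr_realpow power_mult flip: powr_powr)
  finally show ?thesis by (simp add: n)
qed

section \<open>Multi-indices as lists of coordinates, and the final bound\<close>

lemma length_mi_list: "length (mi_list d \<beta>) = mi_abs d \<beta>"
  by (simp add: mi_list_def mi_abs_def length_concat comp_def interv_sum_list_conv_sum_set_nat atLeast0LessThan)

lemma set_mi_list: "set (mi_list d \<beta>) \<subseteq> {..<d}"
  by (auto simp: mi_list_def)

lemma count_list_replicate: "count_list (replicate n x) y = (if x = y then n else 0)"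
  by (induction n) auto

lemma count_list_mi_list: "i < d \<Longrightarrow> count_list (mi_list d \<beta>) i = \<beta> i"
proof (induction d)
  case (Suc d)
  have "count_list (mi_list d \<beta>) d = 0"
    using set_mi_list[of d \<beta>] by (auto simp: count_list_0_iff)
  with Suc show ?case
    by (auto simp: mi_list_def count_list_append count_list_replicate less_Suc_eq)
qed simp

lemma list_fact_mi_list: "list_fact d (mi_list d \<beta>) = mi_fact d \<beta>"
  by (simp add: list_fact_def mi_fact_def count_list_mi_list)

theorem theoremG4:
  fixes c\<^sub>0 :: real
  assumes "0 < c\<^sub>0"
  shows "\<exists>K::real. \<forall>(d::nat) (F :: (nat \<Rightarrow> real) \<Rightarrow> real) (c::real) (\<beta> :: nat \<Rightarrow> nat).
     0 < d \<longrightarrow> F \<in> borel_measurable (lebesgue_d d) \<longrightarrow> bounded (F ` rspace d) \<longrightarrow> 0 < c \<longrightarrow>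
     c\<^sub>0 * real d \<le> real (mi_abs d \<beta>) \<longrightarrow>
       mi_deriv_exists d \<beta> (ft_mollify d c F) \<and>
       supnorm d (mi_deriv d \<beta> (ft_mollify d c F))
         \<le> supnorm d F *
            ennreal (c ^ mi_abs d \<beta> * 2 powr (K * real (mi_abs d \<beta>)) *
              sqrt (real (mi_fact d \<beta>) * real (mi_abs d \<beta>) powr (- real (mi_abs d \<beta>))))"
proof (intro exI[of _ 3] allI impI)
  fix d :: nat and F :: "(nat \<Rightarrow> real) \<Rightarrow> real" and c :: real and \<beta> :: "nat \<Rightarrow> nat"
  assume d: "0 < d" and F: "F \<in> borel_measurable (lebesgue_d d)" and b: "bounded (F ` rspace d)"
    and c: "0 < c" and ge: "c\<^sub>0 * real d \<le> real (mi_abs d \<beta>)"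
  let ?L = "mi_list d \<beta>" and ?n = "mi_abs d \<beta>"
  \<comment> \<open>The order must be positive because \<open>0 powr 0\<close> is 0 here: at order 0
    the right-hand side would vanish.\<close>
  have "0 < c\<^sub>0 * real d" using assms d by simp
  with ge have n: "0 < ?n" by linarith
  obtain B where B: "\<And>x. x \<in> rspace d \<Longrightarrow> \<bar>F x\<bar> \<le> B"
    using b by (auto simp: bounded_iff)
  have "supnorm d F \<le> ennreal B"
    unfolding supnorm_def by (intro SUP_least ennreal_leI B)
  then have "supnorm d F < top"
    by (rule le_less_trans) simp
  \<comment> \<open>The sup norm itself as a real number; the arbitrary bound \<open>B\<close>
    serves only to show that it is finite.\<close>
  then obtain M where M: "supnorm d F = ennreal M" "0 \<le> M"
    by (metis enn2real_nonneg ennreal_enn2real)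
  have FM: "\<bar>F x\<bar> \<le> M" if "x \<in> rspace d" for x
  proof -
    have "ennreal \<bar>F x\<bar> \<le> ennreal M"
      unfolding M(1)[symmetric] supnorm_def using that by (rule SUP_upper)
    then show ?thesis using M(2) by (simp add: ennreal_le_iff)
  qed
  obtain F' where F': "F' \<in> borel_measurable (lborel_d d)" "\<And>y. \<bar>F' y\<bar> \<le> M"
    "\<And>x. x \<in> rspace d \<Longrightarrow> ft_mollify d c F x = conv d (mollifier_deriv d c []) F' x"
    using ft_mollify_eq_conv[OF F FM M(2)] by blast
  have P: "partials_exist d ?L (ft_mollify d c F)"
    "\<And>x. x \<in> rspace d \<Longrightarrow> partials ?L (ft_mollify d c F) x = conv d (mollifier_deriv d c ?L) F' x"
    using partials_of_conv[OF c F' set_mi_list] by blast+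
  have bnd: "ennreal \<bar>conv d (mollifier_deriv d c ?L) F' x\<bar> \<le> ennreal M *
      ennreal (c ^ ?n * 2 powr (3 * real ?n) * sqrt (real (mi_fact d \<beta>) * real ?n powr (- real ?n)))" for x
  proof -
    have "ennreal \<bar>conv d (mollifier_deriv d c ?L) F' x\<bar>
        \<le> ennreal M * (\<integral>\<^sup>+z. ennreal \<bar>mollifier_deriv d c ?L z\<bar> \<partial>lborel_d d)"
      by (rule conv_le[OF mollifier_deriv_measurable[OF set_mi_list] F'(1,2)])
    also have "\<dots> \<le> ennreal M * ennreal (c ^ ?n * (2 ^ ?n * sqrt (2 ^ ?n * mi_fact d \<beta> / fact ?n)))"
      using nn_integral_mollifier_deriv[OF set_mi_list[of d \<beta>] c]
      by (intro mult_left_mono) (auto simp: length_mi_list list_fact_mi_list)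
    also have "\<dots> \<le> ennreal M * ennreal (c ^ ?n * (2 powr (3 * real ?n) *
        sqrt (real (mi_fact d \<beta>) * real ?n powr (- real ?n))))"
      using c multinomial_factor_le[OF n, of "mi_fact d \<beta>"] by (intro mult_left_mono ennreal_leI) auto
    finally show ?thesis by (simp add: mult.assoc)
  qed
  show "mi_deriv_exists d \<beta> (ft_mollify d c F) \<and>
      supnorm d (mi_deriv d \<beta> (ft_mollify d c F))
        \<le> supnorm d F *
          ennreal (c ^ ?n * 2 powr (3 * real ?n) *
            sqrt (real (mi_fact d \<beta>) * real ?n powr (- real ?n)))"
  proof
    show "mi_deriv_exists d \<beta> (ft_mollify d c F)"
      unfolding mi_deriv_exists_def by (rule P(1))
    show "supnorm d (mi_deriv d \<beta> (ft_mollify d c F))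
        \<le> supnorm d F *
          ennreal (c ^ ?n * 2 powr (3 * real ?n) *
            sqrt (real (mi_fact d \<beta>) * real ?n powr (- real ?n)))"
      unfolding M(1) unfolding supnorm_def mi_deriv_def
    proof (rule SUP_least)
      fix x assume x: "x \<in> rspace d"
      show "ennreal \<bar>partials ?L (ft_mollify d c F) x\<bar>
          \<le> ennreal M * ennreal (c ^ ?n * 2 powr (3 * real ?n) *
            sqrt (real (mi_fact d \<beta>) * real ?n powr (- real ?n)))"
        unfolding P(2)[OF x] by (rule bnd)
    qed
  qed
qed

end
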